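(* Let $\mathcal{C}$ be a path category. Then the category $\mathrm{Ex}(\mathcal{C})$, with its fibrations and weak equivalences, is a path category whose homotopy category is equivalent to $\mathrm{Hex}(\mathcal{C})$.
   Context: A path category is a category $\mathcal{C}$ with two classes of maps, fibrations and weak equivalences (maps in both classes are called acyclic fibrations), such that: (1) fibrations are closed under composition; (2) the pullback of a fibration along any map exists and is a fibration; (3) the pullback of an acyclic fibration along any map is an acyclic fibration; (4) 2-out-of-6: if $f:A\to B$, $g:B\to C$, $h:C\to D$ and $gf$, $hg$ are weak equivalences, then so are $f,g,h,hgf$; (5) isomorphisms are acyclic fibrations and every acyclic fibration has a section; (6) every object $B$ has a path object, i.e. a factorisation of the diagonal $B \to B\times B$ as a weak equivalence $r: B \to PB$ followed by a fibration $(s,t): PB \to B \times B$; (7) there is a terminal object $1$ and every map $X \to 1$ is a fibration. In a path category, $f,g: Y \to X$ are homotopic, $f \simeq g$, if for some path object $PX$ there is $h: Y \to PX$ with $sh = f$, $th = g$; this is a congruence independent of the choice of path object, and the homotopy category is the quotient of the path category by $\simeq$. A homotopy equivalence relation on $X$ in $\mathcal{C}$ is a fibration $p=(p_1,p_2): R \to X \times X$ such that there exist: $\rho: X \to R$ with $p\rho = \Delta_X$; $\sigma: R \to R$ with $p_1\sigma = p_2$, $p_2\sigma = p_1$; and, for the pullback $R\times_X R$ of $p_2$ and $p_1$ with projections $q_1,q_2$ (so $p_2q_1 = p_1q_2$), a map $\tau: R\times_X R \to R$ with $p_1\tau = p_1q_1$ and $p_2\tau = p_2q_2$. $\mathrm{Hex}(\mathcal{C})$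 has as objects the pairs $(X, \rho: R \to X\times X)$ with $\rho$ a homotopy equivalence relation in $\mathcal{C}$. A morphism $(X,\rho:R\to X\times X) \to (Y,\sigma: S\to Y\times Y)$ is an equivalence class of maps $f: X \to Y$ in $\mathcal{C}$ for which there is $\varphi: R \to S$ with $\sigma\varphi = (f\times f)\rho$; two such $f,g$ are identified if there is $H: X \to S$ with $\sigma H = (f,g)$. $\mathrm{Ex}(\mathcal{C})$ has the same objects as $\mathrm{Hex}(\mathcal{C})$; a morphism $(X,\rho:R\to X\times X) \to (Y,\sigma: S\to Y\times Y)$ is a map $f: X \to Y$ in $\mathcal{C}$ for which there exists $\varphi: R \to S$ with $\sigma\varphi = (f\times f)\rho$. For two such morphisms write $f \sim g$ if there is $H: X \to S$ with $\sigma H = (f,g)$. Write $\rho = (\rho_1,\rho_2)$ and $\sigma = (\sigma_1,\sigma_2)$. The morphism $f$ is a fibration in $\mathrm{Ex}(\mathcal{C})$ if (1) $f$ is a fibration in $\mathcal{C}$, and (2) for the pullback $X\times_Y S$ of $f$ and $\sigma_1$, with projections $p_1: X\times_Y S\to X$ and $p_2: X\times_Y S \to S$, there is a map $\nabla: X\times_Y S \to R$ in $\mathcal{C}$ with $\rho_1\nabla = p_1$ and $f\rho_2\nabla = \sigma_2p_2$. The morphism $f$ is a weak equivalence in $\mathrm{Ex}(\mathcal{C})$ if there is a morphism $g: (Y,S) \to (X,R)$ in $\mathrm{Ex}(\mathcal{C})$ with $fg \sim 1_Y$ and $gf \sim 1_X$. *)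

theory Defs
  imports Main
begin

section \<open>Categories, functors and equivalences\<close>

text \<open>\<open>g \<cdot> f\<close> is \<open>g\<close> after \<open>f\<close>. All operations are only meaningful on the carriers
  \<open>Obj\<close> and \<open>Arr\<close> (and composition only on composable arrows).\<close>

record ('o, 'm) category =
  Obj :: "'o set"
  Arr :: "'m set"
  Dom :: "'m \<Rightarrow> 'o"
  Cod :: "'m \<Rightarrow> 'o"
  Ident :: "'o \<Rightarrow> 'm" ("\<one>\<index>")
  Comp :: "'m \<Rightarrow> 'm \<Rightarrow> 'm" (infixr "\<cdot>\<index>" 70)

definition Hom :: "('o, 'm, 'z) category_scheme \<Rightarrow> 'o \<Rightarrow> 'o \<Rightarrow> 'm set" where
  "Hom C A B = {f \<in> Arr C. Dom C f = A \<and> Cod C f = B}"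

locale category =
  fixes C :: "('o, 'm, 'z) category_scheme" (structure)
  assumes dom_obj: "f \<in> Arr C \<Longrightarrow> Dom C f \<in> Obj C"
    and cod_obj: "f \<in> Arr C \<Longrightarrow> Cod C f \<in> Obj C"
    and ident_hom: "A \<in> Obj C \<Longrightarrow> \<one> A \<in> Hom C A A"
    and comp_hom: "\<lbrakk>f \<in> Hom C A B; g \<in> Hom C B D\<rbrakk> \<Longrightarrow> g \<cdot> f \<in> Hom C A D"
    and ident_left: "f \<in> Hom C A B \<Longrightarrow> \<one> B \<cdot> f = f"
    and ident_right: "f \<in> Hom C A B \<Longrightarrow> f \<cdot> \<one> A = f"
    and comp_assoc: "\<lbrakk>f \<in> Hom C A B; g \<in> Hom C B D; h \<in> Hom C D E\<rbrakk>
          \<Longrightarrow> (h \<cdot> g) \<cdot> f = h \<cdot> (g \<cdot> f)"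

definition is_iso :: "('o, 'm, 'z) category_scheme \<Rightarrow> 'm \<Rightarrow> bool" where
  "is_iso C f \<longleftrightarrow> f \<in> Arr C \<and>
     (\<exists>g \<in> Hom C (Cod C f) (Dom C f).
        g \<cdot>\<^bsub>C\<^esub> f = \<one>\<^bsub>C\<^esub> (Dom C f) \<and> f \<cdot>\<^bsub>C\<^esub> g = \<one>\<^bsub>C\<^esub> (Cod C f))"

locale cat_functor = A: category A + B: category B
  for A :: "('o1, 'm1, 'z1) category_scheme" and B :: "('o2, 'm2, 'z2) category_scheme" +
  fixes Fo :: "'o1 \<Rightarrow> 'o2" and Fa :: "'m1 \<Rightarrow> 'm2"
  assumes map_obj: "X \<in> Obj A \<Longrightarrow> Fo X \<in> Obj B"
    and map_hom: "f \<in> Hom A X Y \<Longrightarrow> Fa f \<in> Hom B (Fo X) (Fo Y)"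
    and map_ident: "X \<in> Obj A \<Longrightarrow> Fa (\<one>\<^bsub>A\<^esub> X) = \<one>\<^bsub>B\<^esub> (Fo X)"
    and map_comp: "\<lbrakk>f \<in> Hom A X Y; g \<in> Hom A Y Z\<rbrakk> \<Longrightarrow> Fa (g \<cdot>\<^bsub>A\<^esub> f) = Fa g \<cdot>\<^bsub>B\<^esub> Fa f"

definition naturally_isomorphic ::
  "('o1, 'm1, 'z1) category_scheme \<Rightarrow> ('o2, 'm2, 'z2) category_scheme \<Rightarrow>
   ('o1 \<Rightarrow> 'o2) \<Rightarrow> ('m1 \<Rightarrow> 'm2) \<Rightarrow> ('o1 \<Rightarrow> 'o2) \<Rightarrow> ('m1 \<Rightarrow> 'm2) \<Rightarrow> bool" where
  "naturally_isomorphic A B Fo Fa Go Ga \<longleftrightarrow>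
     cat_functor A B Fo Fa \<and> cat_functor A B Go Ga \<and>
     (\<exists>\<eta>. (\<forall>X \<in> Obj A. \<eta> X \<in> Hom B (Fo X) (Go X) \<and> is_iso B (\<eta> X)) \<and>
          (\<forall>f \<in> Arr A. Ga f \<cdot>\<^bsub>B\<^esub> \<eta> (Dom A f) = \<eta> (Cod A f) \<cdot>\<^bsub>B\<^esub> Fa f))"

definition equivalent_categories ::
  "('o1, 'm1, 'z1) category_scheme \<Rightarrow> ('o2, 'm2, 'z2) category_scheme \<Rightarrow> bool" where
  "equivalent_categories A B \<longleftrightarrow>
     (\<exists>Fo Fa Go Ga. cat_functor A B Fo Fa \<and> cat_functor B A Go Ga \<and>
        naturally_isomorphic A A (Go \<circ> Fo) (Ga \<circ> Fa) id id \<and>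
        naturally_isomorphic B B (Fo \<circ> Go) (Fa \<circ> Ga) id id)"

section \<open>Limits\<close>

definition is_terminal :: "('o, 'm, 'z) category_scheme \<Rightarrow> 'o \<Rightarrow> bool" where
  "is_terminal C T \<longleftrightarrow> T \<in> Obj C \<and> (\<forall>A \<in> Obj C. \<exists>!f. f \<in> Hom C A T)"

definition is_pullback :: "('o, 'm, 'z) category_scheme \<Rightarrow> 'm \<Rightarrow> 'm \<Rightarrow> 'm \<Rightarrow> 'm \<Rightarrow> bool" where
  "is_pullback C f g p q \<longleftrightarrow>
     f \<in> Arr C \<and> g \<in> Arr C \<and> Cod C f = Cod C g \<and>
     p \<in> Arr C \<and> q \<in> Arr C \<and> Dom C p = Dom C q \<and> Cod C p = Dom C f \<and> Cod C q = Dom C g \<and>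
     f \<cdot>\<^bsub>C\<^esub> p = g \<cdot>\<^bsub>C\<^esub> q \<and>
     (\<forall>A. \<forall>u \<in> Hom C A (Dom C f). \<forall>v \<in> Hom C A (Dom C g).
        f \<cdot>\<^bsub>C\<^esub> u = g \<cdot>\<^bsub>C\<^esub> v \<longrightarrow>
        (\<exists>!w. w \<in> Hom C A (Dom C p) \<and> p \<cdot>\<^bsub>C\<^esub> w = u \<and> q \<cdot>\<^bsub>C\<^esub> w = v))"

definition is_product :: "('o, 'm, 'z) category_scheme \<Rightarrow> 'o \<Rightarrow> 'o \<Rightarrow> 'o \<times> 'm \<times> 'm \<Rightarrow> bool" where
  "is_product C A B = (\<lambda>(P, p, q).
     A \<in> Obj C \<and> B \<in> Obj C \<and> p \<in> Hom C P A \<and> q \<in> Hom C P B \<and>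
     (\<forall>D. \<forall>u \<in> Hom C D A. \<forall>v \<in> Hom C D B.
        \<exists>!w. w \<in> Hom C D P \<and> p \<cdot>\<^bsub>C\<^esub> w = u \<and> q \<cdot>\<^bsub>C\<^esub> w = v))"

text \<open>The notation \<open>A \<times> B\<close> refers to a fixed choice of binary products. In a path category all
  binary products exist, as pullbacks over the terminal object.\<close>

definition prod_cone :: "('o, 'm, 'z) category_scheme \<Rightarrow> 'o \<Rightarrow> 'o \<Rightarrow> 'o \<times> 'm \<times> 'm" where
  "prod_cone C A B = (SOME c. is_product C A B c)"

definition prod_obj :: "('o, 'm, 'z) category_scheme \<Rightarrow> 'o \<Rightarrow> 'o \<Rightarrow> 'o" where
  "prod_obj C A B = fst (prod_cone C A B)"

definition proj1 :: "('o, 'm, 'z) category_scheme \<Rightarrow> 'o \<Rightarrow> 'o \<Rightarrow> 'm" where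
  "proj1 C A B = fst (snd (prod_cone C A B))"

definition proj2 :: "('o, 'm, 'z) category_scheme \<Rightarrow> 'o \<Rightarrow> 'o \<Rightarrow> 'm" where
  "proj2 C A B = snd (snd (prod_cone C A B))"

definition pairing :: "('o, 'm, 'z) category_scheme \<Rightarrow> 'm \<Rightarrow> 'm \<Rightarrow> 'm" where
  "pairing C f g =
     (THE w. w \<in> Hom C (Dom C f) (prod_obj C (Cod C f) (Cod C g)) \<and>
        proj1 C (Cod C f) (Cod C g) \<cdot>\<^bsub>C\<^esub> w = f \<and> proj2 C (Cod C f) (Cod C g) \<cdot>\<^bsub>C\<^esub> w = g)"

definition diag :: "('o, 'm, 'z) category_scheme \<Rightarrow> 'o \<Rightarrow> 'm" where
  "diag C A = pairing C (\<one>\<^bsub>C\<^esub> A) (\<one>\<^bsub>C\<^esub> A)"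

definition prod_map :: "('o, 'm, 'z) category_scheme \<Rightarrow> 'm \<Rightarrow> 'm \<Rightarrow> 'm" where
  "prod_map C f g =
     pairing C (f \<cdot>\<^bsub>C\<^esub> proj1 C (Dom C f) (Dom C g)) (g \<cdot>\<^bsub>C\<^esub> proj2 C (Dom C f) (Dom C g))"

text \<open>The two components of an arrow \<open>p = (p1, p2) : R \<rightarrow> X \<times> X\<close>.\<close>

definition comp1 :: "('o, 'm, 'z) category_scheme \<Rightarrow> 'o \<Rightarrow> 'm \<Rightarrow> 'm" where
  "comp1 C X p = proj1 C X X \<cdot>\<^bsub>C\<^esub> p"

definition comp2 :: "('o, 'm, 'z) category_scheme \<Rightarrow> 'o \<Rightarrow> 'm \<Rightarrow> 'm" where
  "comp2 C X p = proj2 C X X \<cdot>\<^bsub>C\<^esub> p"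

section \<open>Path categories\<close>

record ('o, 'm) path_structure = "('o, 'm) category" +
  Fib :: "'m set"
  Weq :: "'m set"

text \<open>A path object on \<open>B\<close> is given by its two arrows \<open>r : B \<rightarrow> PB\<close> and
  \<open>p = (s, t) : PB \<rightarrow> B \<times> B\<close>.\<close>

definition path_object ::
  "('o, 'm, 'z) path_structure_scheme \<Rightarrow> 'o \<Rightarrow> 'm \<Rightarrow> 'm \<Rightarrow> bool" where
  "path_object C B r p \<longleftrightarrow>
     r \<in> Hom C B (Dom C p) \<and> p \<in> Hom C (Dom C p) (prod_obj C B B) \<and>
     r \<in> Weq C \<and> p \<in> Fib C \<and> p \<cdot>\<^bsub>C\<^esub> r = diag C B"

locale path_category = category C
  for C :: "('o, 'm, 'z) path_structure_scheme" (structure) +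
  assumes fib_arr: "Fib C \<subseteq> Arr C"
    and weq_arr: "Weq C \<subseteq> Arr C"
    and fib_comp: "\<lbrakk>f \<in> Fib C; g \<in> Fib C; Cod C f = Dom C g\<rbrakk> \<Longrightarrow> g \<cdot> f \<in> Fib C"
    and pullback_exists: "\<lbrakk>f \<in> Fib C; g \<in> Arr C; Cod C g = Cod C f\<rbrakk> \<Longrightarrow> \<exists>p q. is_pullback C f g p q"
    and pullback_fib: "\<lbrakk>f \<in> Fib C; is_pullback C f g p q\<rbrakk> \<Longrightarrow> q \<in> Fib C"
    and pullback_acyclic_fib:
      "\<lbrakk>f \<in> Fib C \<inter> Weq C; is_pullback C f g p q\<rbrakk> \<Longrightarrow> q \<in> Fib C \<inter> Weq C"
    and two_out_of_six:
      "\<lbrakk>f \<in> Hom C A B; g \<in> Hom C B D; h \<in> Hom C D E; g \<cdot> f \<in> Weq C; h \<cdot> g \<in> Weq C\<rbrakk>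
         \<Longrightarrow> f \<in> Weq C \<and> g \<in> Weq C \<and> h \<in> Weq C \<and> h \<cdot> g \<cdot> f \<in> Weq C"
    and iso_acyclic_fib: "is_iso C f \<Longrightarrow> f \<in> Fib C \<inter> Weq C"
    and acyclic_fib_section:
      "f \<in> Fib C \<inter> Weq C \<Longrightarrow> \<exists>a \<in> Hom C (Cod C f) (Dom C f). f \<cdot> a = \<one> (Cod C f)"
    and path_object_exists: "B \<in> Obj C \<Longrightarrow> \<exists>r p. path_object C B r p"
    and terminal: "\<exists>T. is_terminal C T \<and> (\<forall>X \<in> Obj C. Hom C X T \<subseteq> Fib C)"

definition homotopic :: "('o, 'm, 'z) path_structure_scheme \<Rightarrow> 'm \<Rightarrow> 'm \<Rightarrow> bool" where
  "homotopic C f g \<longleftrightarrow>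
     (\<exists>Y X. f \<in> Hom C Y X \<and> g \<in> Hom C Y X \<and>
        (\<exists>r p. path_object C X r p \<and>
           (\<exists>h \<in> Hom C Y (Dom C p).
              comp1 C X p \<cdot>\<^bsub>C\<^esub> h = f \<and> comp2 C X p \<cdot>\<^bsub>C\<^esub> h = g)))"

definition homotopy_class :: "('o, 'm, 'z) path_structure_scheme \<Rightarrow> 'm \<Rightarrow> 'm set" where
  "homotopy_class C f = {g. homotopic C f g}"

text \<open>All members of a homotopy class have the same domain and codomain, and any two composites of
  members of two composable classes are homotopic, so the choices and the union below are harmless.\<close>

definition homotopy_category ::
  "('o, 'm, 'z) path_structure_scheme \<Rightarrow> ('o, 'm set) category" where
  "homotopy_category C =
     \<lparr>Obj = Obj C,
      Arr = homotopy_class C ` Arr C,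
      Dom = (\<lambda>F. Dom C (SOME f. f \<in> F)),
      Cod = (\<lambda>F. Cod C (SOME f. f \<in> F)),
      Ident = (\<lambda>X. homotopy_class C (\<one>\<^bsub>C\<^esub> X)),
      Comp = (\<lambda>G F. \<Union>g \<in> G. \<Union>f \<in> F. homotopy_class C (g \<cdot>\<^bsub>C\<^esub> f))\<rparr>"

section \<open>Homotopy equivalence relations\<close>

definition homotopy_equivalence_relation ::
  "('o, 'm, 'z) path_structure_scheme \<Rightarrow> 'o \<Rightarrow> 'm \<Rightarrow> bool" where
  "homotopy_equivalence_relation C X p \<longleftrightarrow>
     (let R = Dom C p; p1 = comp1 C X p; p2 = comp2 C X p in
      X \<in> Obj C \<and> p \<in> Hom C R (prod_obj C X X) \<and> p \<in> Fib C \<and>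
      (\<exists>\<rho> \<in> Hom C X R. p \<cdot>\<^bsub>C\<^esub> \<rho> = diag C X) \<and>
      (\<exists>\<sigma> \<in> Hom C R R. p1 \<cdot>\<^bsub>C\<^esub> \<sigma> = p2 \<and> p2 \<cdot>\<^bsub>C\<^esub> \<sigma> = p1) \<and>
      (\<exists>q1 q2. is_pullback C p2 p1 q1 q2 \<and>
         (\<exists>\<tau> \<in> Hom C (Dom C q1) R.
            p1 \<cdot>\<^bsub>C\<^esub> \<tau> = p1 \<cdot>\<^bsub>C\<^esub> q1 \<and> p2 \<cdot>\<^bsub>C\<^esub> \<tau> = p2 \<cdot>\<^bsub>C\<^esub> q2)))"

definition her_objects :: "('o, 'm, 'z) path_structure_scheme \<Rightarrow> ('o \<times> 'm) set" where
  "her_objects C = {(X, \<rho>). homotopy_equivalence_relation C X \<rho>}"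

definition tracked ::
  "('o, 'm, 'z) path_structure_scheme \<Rightarrow> 'o \<times> 'm \<Rightarrow> 'o \<times> 'm \<Rightarrow> 'm \<Rightarrow> bool" where
  "tracked C = (\<lambda>(X, \<rho>) (Y, \<sigma>) f.
     f \<in> Hom C X Y \<and>
     (\<exists>\<phi> \<in> Hom C (Dom C \<rho>) (Dom C \<sigma>). \<sigma> \<cdot>\<^bsub>C\<^esub> \<phi> = prod_map C f f \<cdot>\<^bsub>C\<^esub> \<rho>))"

definition tracked_equiv ::
  "('o, 'm, 'z) path_structure_scheme \<Rightarrow> 'o \<times> 'm \<Rightarrow> 'o \<times> 'm \<Rightarrow> 'm \<Rightarrow> 'm \<Rightarrow> bool" where
  "tracked_equiv C = (\<lambda>(X, \<rho>) (Y, \<sigma>) f g.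
     tracked C (X, \<rho>) (Y, \<sigma>) f \<and> tracked C (X, \<rho>) (Y, \<sigma>) g \<and>
     (\<exists>H \<in> Hom C X (Dom C \<sigma>). \<sigma> \<cdot>\<^bsub>C\<^esub> H = pairing C f g))"

section \<open>The categories Hex and Ex\<close>

text \<open>An arrow of \<open>Hex_cat C\<close> or \<open>Ex_cat C\<close> carries its domain and codomain as the outer components of a
  triple, since neither is determined by the underlying map of \<open>C\<close>.\<close>

definition tracked_class ::
  "('o, 'm, 'z) path_structure_scheme \<Rightarrow> 'o \<times> 'm \<Rightarrow> 'o \<times> 'm \<Rightarrow> 'm \<Rightarrow> 'm set" where
  "tracked_class C A B f = {g. tracked_equiv C A B f g}"

definition Hex_cat ::
  "('o, 'm, 'z) path_structure_scheme \<Rightarrow>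
   ('o \<times> 'm, ('o \<times> 'm) \<times> 'm set \<times> ('o \<times> 'm)) category" where
  "Hex_cat C =
     \<lparr>Obj = her_objects C,
      Arr = {(A, tracked_class C A B f, B) | A B f.
               A \<in> her_objects C \<and> B \<in> her_objects C \<and> tracked C A B f},
      Dom = (\<lambda>(A, F, B). A),
      Cod = (\<lambda>(A, F, B). B),
      Ident = (\<lambda>A. (A, tracked_class C A A (\<one>\<^bsub>C\<^esub> (fst A)), A)),
      Comp = (\<lambda>(B', G, D) (A, F, B).
                (A, \<Union>g \<in> G. \<Union>f \<in> F. tracked_class C A D (g \<cdot>\<^bsub>C\<^esub> f), D))\<rparr>"

definition Ex_arrows ::
  "('o, 'm, 'z) path_structure_scheme \<Rightarrow> (('o \<times> 'm) \<times> 'm \<times> ('o \<times> 'm)) set" where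
  "Ex_arrows C =
     {(A, f, B). A \<in> her_objects C \<and> B \<in> her_objects C \<and> tracked C A B f}"

definition Ex_fibrations ::
  "('o, 'm, 'z) path_structure_scheme \<Rightarrow> (('o \<times> 'm) \<times> 'm \<times> ('o \<times> 'm)) set" where
  "Ex_fibrations C =
     {((X, \<rho>), f, (Y, \<sigma>)). ((X, \<rho>), f, (Y, \<sigma>)) \<in> Ex_arrows C \<and> f \<in> Fib C \<and>
        (\<exists>p1 p2. is_pullback C f (comp1 C Y \<sigma>) p1 p2 \<and>
           (\<exists>\<nu> \<in> Hom C (Dom C p1) (Dom C \<rho>).
              comp1 C X \<rho> \<cdot>\<^bsub>C\<^esub> \<nu> = p1 \<and>
              f \<cdot>\<^bsub>C\<^esub> comp2 C X \<rho> \<cdot>\<^bsub>C\<^esub> \<nu> = comp2 C Y \<sigma> \<cdot>\<^bsub>C\<^esub> p2))}"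

definition Ex_weak_equivalences ::
  "('o, 'm, 'z) path_structure_scheme \<Rightarrow> (('o \<times> 'm) \<times> 'm \<times> ('o \<times> 'm)) set" where
  "Ex_weak_equivalences C =
     {(A, f, B). (A, f, B) \<in> Ex_arrows C \<and>
        (\<exists>g. (B, g, A) \<in> Ex_arrows C \<and>
           tracked_equiv C B B (f \<cdot>\<^bsub>C\<^esub> g) (\<one>\<^bsub>C\<^esub> (fst B)) \<and>
           tracked_equiv C A A (g \<cdot>\<^bsub>C\<^esub> f) (\<one>\<^bsub>C\<^esub> (fst A)))}"

definition Ex_cat ::
  "('o, 'm, 'z) path_structure_scheme \<Rightarrow>
   ('o \<times> 'm, ('o \<times> 'm) \<times> 'm \<times> ('o \<times> 'm)) path_structure" where
  "Ex_cat C =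
     \<lparr>Obj = her_objects C,
      Arr = Ex_arrows C,
      Dom = (\<lambda>(A, f, B). A),
      Cod = (\<lambda>(A, f, B). B),
      Ident = (\<lambda>A. (A, \<one>\<^bsub>C\<^esub> (fst A), A)),
      Comp = (\<lambda>(B', g, D) (A, f, B). (A, g \<cdot>\<^bsub>C\<^esub> f, D)),
      Fib = Ex_fibrations C,
      Weq = Ex_weak_equivalences C\<rparr>"

end

theory Submission
  imports Defs
begin

text \<open>A fibration \<open>R \<rightarrow> X \<times> X\<close> defines a binary relation on the generalised elements \<open>D \<rightarrow> X\<close>, and it
  is a homotopy equivalence relation iff these relations are equivalence relations for all \<open>D\<close>; tracked
  maps are those preserving the relations, and fibrations of Ex are those fibrations \<open>f\<close> for which every
  \<open>f u \<sim> w\<close> has the form \<open>w = f v\<close> with \<open>u \<sim> v\<close>. Among these, the acyclic ones are those that have a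
  section and reflect the relations, a property that is visibly stable under pullback. Pullbacks and path
  objects carry relations obtained by inverse image and intersection; \<open>R\<close> itself is a path object
  of \<open>(X, R)\<close>. Conversely the two legs of any path object are related, because both are inverse to
  the same weak equivalence. Hence two arrows of Ex are homotopic iff they are identified in Hex, so that
  the homotopy category and Hex are quotients of Ex by the same congruence.\<close>

section \<open>Pullbacks and products\<close>

text \<open>Each witness in the definitions (reflexivity, symmetry and transitivity of a relation,
  the map tracking a morphism, the lift of a fibration) solves one universal instance of a
  condition: on an identity, on the two legs of \<open>R\<close>, or on the projections of a
  pullback. Precomposing the witness settles every other instance, and the universal instance gives
  the witness back. This turns diagram chases into chains of related arrows in the sets Hom(D, X).
  For acyclic fibrations the obstacle is that a homotopy inverse satisfies its equations only up to
  ~, whereas an arrow into a pullback needs strict commutation. Lifting the relation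
  \<open>f g ~ 1\<close> along \<open>f\<close>, starting at \<open>g\<close>, replaces
  \<open>g\<close> by a strict section, and strict sections do pull back. The other obstacle is
  choice: the pullback axioms speak of every pullback, and path objects refer to an arbitrarily
  chosen product, while relations are known only on objects built by hand. Comparison isomorphisms
  bridge this gap, using that isomorphisms of Ex are acyclic fibrations.\<close>

lemma in_Hom: "f \<in> Hom C A B \<longleftrightarrow> f \<in> Arr C \<and> Dom C f = A \<and> Cod C f = B"
  by (auto simp: Hom_def)

context category
begin

lemma Hom_dom_obj: "f \<in> Hom C A B \<Longrightarrow> A \<in> Obj C"
  and Hom_cod_obj: "f \<in> Hom C A B \<Longrightarrow> B \<in> Obj C"
  using dom_obj cod_obj by (auto simp: in_Hom)

lemma arr_simps:
  assumes "f \<in> Arr C"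
  shows "\<lbrakk>g \<in> Arr C; Cod C f = Dom C g\<rbrakk> \<Longrightarrow> g \<cdot> f \<in> Arr C"
    and "\<lbrakk>g \<in> Arr C; Cod C f = Dom C g\<rbrakk> \<Longrightarrow> Dom C (g \<cdot> f) = Dom C f"
    and "\<lbrakk>g \<in> Arr C; Cod C f = Dom C g\<rbrakk> \<Longrightarrow> Cod C (g \<cdot> f) = Cod C g"
    and "\<lbrakk>g \<in> Arr C; Cod C f = Dom C g; h \<in> Arr C; Cod C g = Dom C h\<rbrakk>
           \<Longrightarrow> (h \<cdot> g) \<cdot> f = h \<cdot> (g \<cdot> f)"
    and "Dom C f = A \<Longrightarrow> f \<cdot> \<one> A = f"
    and "Cod C f = B \<Longrightarrow> \<one> B \<cdot> f = f"
  using assms comp_hom[of f "Dom C f" "Cod C f" g "Cod C g"]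
    comp_assoc[of f "Dom C f" "Cod C f" g "Cod C g" h "Cod C h"]
    ident_left[of f "Dom C f" "Cod C f"] ident_right[of f "Dom C f" "Cod C f"]
  by (auto simp: in_Hom)

section \<open>Pullbacks: universal property, symmetry, uniqueness up to isomorphism\<close>

lemma pullbackI:
  assumes "f \<in> Hom C X Z" "g \<in> Hom C Y Z" "p \<in> Hom C P X" "q \<in> Hom C P Y" "f \<cdot> p = g \<cdot> q"
    and "\<And>D u v. \<lbrakk>u \<in> Hom C D X; v \<in> Hom C D Y; f \<cdot> u = g \<cdot> v\<rbrakk>
           \<Longrightarrow> \<exists>w \<in> Hom C D P. p \<cdot> w = u \<and> q \<cdot> w = v"
    and "\<And>D w w'. \<lbrakk>w \<in> Hom C D P; w' \<in> Hom C D P; p \<cdot> w = p \<cdot> w'; q \<cdot> w = q \<cdot> w'\<rbrakk> \<Longrightarrow> w = w'"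
  shows "is_pullback C f g p q"
proof -
  have "\<exists>!w. w \<in> Hom C D P \<and> p \<cdot> w = u \<and> q \<cdot> w = v"
    if "u \<in> Hom C D X" "v \<in> Hom C D Y" "f \<cdot> u = g \<cdot> v" for D u v
    using assms(6)[OF that] assms(7) by (metis (no_types, lifting))
  moreover have "f \<in> Arr C \<and> g \<in> Arr C \<and> Cod C f = Cod C g \<and> p \<in> Arr C \<and> q \<in> Arr C \<and>
      Dom C p = Dom C q \<and> Cod C p = Dom C f \<and> Cod C q = Dom C g \<and> f \<cdot> p = g \<cdot> q"
    using assms(1-5) by (simp add: in_Hom)
  moreover have "Dom C f = X" "Dom C g = Y" "Dom C p = P" using assms(1-3) by (simp_all add: in_Hom)
  ultimately show ?thesis
    unfolding is_pullback_def by simp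
qed

lemma pullback_homs:
  assumes "is_pullback C f g p q"
  shows "f \<in> Hom C (Dom C f) (Cod C f)" "g \<in> Hom C (Dom C g) (Cod C f)"
    "p \<in> Hom C (Dom C p) (Dom C f)" "q \<in> Hom C (Dom C p) (Dom C g)" "f \<cdot> p = g \<cdot> q"
  using assms unfolding is_pullback_def by (auto simp: in_Hom)

lemma pullback_lift:
  assumes "is_pullback C f g p q" "u \<in> Hom C D (Dom C f)" "v \<in> Hom C D (Dom C g)" "f \<cdot> u = g \<cdot> v"
  shows "\<exists>w \<in> Hom C D (Dom C p). p \<cdot> w = u \<and> q \<cdot> w = v"
  using assms unfolding is_pullback_def by blast

lemma pullback_ext:
  assumes pb: "is_pullback C f g p q" and w: "w \<in> Hom C D (Dom C p)" "w' \<in> Hom C D (Dom C p)"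
    and eq: "p \<cdot> w = p \<cdot> w'" "q \<cdot> w = q \<cdot> w'"
  shows "w = w'"
proof -
  note h = pullback_homs[OF pb]
  have "p \<cdot> w \<in> Hom C D (Dom C f)" "q \<cdot> w \<in> Hom C D (Dom C g)"
    using comp_hom h w by blast+
  moreover have "f \<cdot> (p \<cdot> w) = g \<cdot> (q \<cdot> w)"
    using comp_assoc[OF w(1) h(3,1)] comp_assoc[OF w(1) h(4,2)] h(5) by simp
  ultimately have "\<exists>!x. x \<in> Hom C D (Dom C p) \<and> p \<cdot> x = p \<cdot> w \<and> q \<cdot> x = q \<cdot> w"
    using pb unfolding is_pullback_def by blast
  then show ?thesis using w eq by metis
qed

lemma pullback_commute:
  assumes "is_pullback C f g p q"
  shows "is_pullback C g f q p"
proof -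
  note h = pullback_homs[OF assms]
  show ?thesis
  proof (rule pullbackI[OF h(2,1,4,3) h(5)[symmetric]])
    show "\<exists>w \<in> Hom C D (Dom C p). q \<cdot> w = u \<and> p \<cdot> w = v"
      if "u \<in> Hom C D (Dom C g)" "v \<in> Hom C D (Dom C f)" "g \<cdot> u = f \<cdot> v" for D u v
      using pullback_lift[OF assms that(2,1) that(3)[symmetric]] by blast
    show "w = w'" if "w \<in> Hom C D (Dom C p)" "w' \<in> Hom C D (Dom C p)"
      "q \<cdot> w = q \<cdot> w'" "p \<cdot> w = p \<cdot> w'" for D w w'
      using pullback_ext[OF assms that(1,2,4,3)] .
  qed
qed

lemma isoI:
  assumes "f \<in> Hom C A B" "g \<in> Hom C B A" "g \<cdot> f = \<one> A" "f \<cdot> g = \<one> B"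
  shows "is_iso C f"
  using assms unfolding is_iso_def by (auto simp: in_Hom)

text \<open>The common core of uniqueness for pullbacks and products: both composites of the two
  comparison arrows fix the legs of a cone, and jointly monic legs force such an endomorphism to be
  the identity.\<close>

lemma jointly_monic_iso:
  assumes h: "p \<in> Hom C P X" "q \<in> Hom C P Y" "p' \<in> Hom C P' X" "q' \<in> Hom C P' Y"
    and ext: "\<And>w w'. \<lbrakk>w \<in> Hom C P P; w' \<in> Hom C P P; p \<cdot> w = p \<cdot> w'; q \<cdot> w = q \<cdot> w'\<rbrakk> \<Longrightarrow> w = w'"
    and ext': "\<And>w w'. \<lbrakk>w \<in> Hom C P' P'; w' \<in> Hom C P' P'; p' \<cdot> w = p' \<cdot> w'; q' \<cdot> w = q' \<cdot> w'\<rbrakk>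
                \<Longrightarrow> w = w'"
    and e: "e \<in> Hom C P' P" "p \<cdot> e = p'" "q \<cdot> e = q'"
    and d: "d \<in> Hom C P P'" "p' \<cdot> d = p" "q' \<cdot> d = q"
  shows "is_iso C e"
proof (rule isoI[OF e(1) d(1)])
  have P: "P \<in> Obj C" "P' \<in> Obj C" using Hom_dom_obj h by blast+
  show "d \<cdot> e = \<one> P'"
  proof (rule ext')
    show "p' \<cdot> d \<cdot> e = p' \<cdot> \<one> P'" "q' \<cdot> d \<cdot> e = q' \<cdot> \<one> P'"
      using comp_assoc[OF e(1) d(1) h(3)] comp_assoc[OF e(1) d(1) h(4)] e d
        ident_right[OF h(3)] ident_right[OF h(4)] by simp_all
  qed (use comp_hom e d ident_hom P in blast)+
  show "e \<cdot> d = \<one> P"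
  proof (rule ext)
    show "p \<cdot> e \<cdot> d = p \<cdot> \<one> P" "q \<cdot> e \<cdot> d = q \<cdot> \<one> P"
      using comp_assoc[OF d(1) e(1) h(1)] comp_assoc[OF d(1) e(1) h(2)] e d
        ident_right[OF h(1)] ident_right[OF h(2)] by simp_all
  qed (use comp_hom e d ident_hom P in blast)+
qed

lemma pullback_unique:
  assumes pb: "is_pullback C f g p q" and pb': "is_pullback C f g p' q'"
  obtains e where "is_iso C e" "e \<in> Hom C (Dom C p') (Dom C p)" "p \<cdot> e = p'" "q \<cdot> e = q'"
proof -
  note h = pullback_homs[OF pb] and h' = pullback_homs[OF pb']
  obtain e where e: "e \<in> Hom C (Dom C p') (Dom C p)" "p \<cdot> e = p'" "q \<cdot> e = q'"
    using pullback_lift[OF pb h'(3-5)] by blast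
  obtain d where d: "d \<in> Hom C (Dom C p) (Dom C p')" "p' \<cdot> d = p" "q' \<cdot> d = q"
    using pullback_lift[OF pb' h(3-5)] by blast
  have "is_iso C e"
    using jointly_monic_iso[OF h(3,4) h'(3,4) pullback_ext[OF pb] pullback_ext[OF pb'] e d] .
  then show thesis using that e by blast
qed

section \<open>Binary products and pullbacks over a terminal object\<close>

lemma productI:
  assumes "p \<in> Hom C P A" "q \<in> Hom C P B"
    and "\<And>D u v. \<lbrakk>u \<in> Hom C D A; v \<in> Hom C D B\<rbrakk> \<Longrightarrow> \<exists>w \<in> Hom C D P. p \<cdot> w = u \<and> q \<cdot> w = v"
    and "\<And>D w w'. \<lbrakk>w \<in> Hom C D P; w' \<in> Hom C D P; p \<cdot> w = p \<cdot> w'; q \<cdot> w = q \<cdot> w'\<rbrakk> \<Longrightarrow> w = w'"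
  shows "is_product C A B (P, p, q)"
proof -
  have "\<exists>!w. w \<in> Hom C D P \<and> p \<cdot> w = u \<and> q \<cdot> w = v"
    if "u \<in> Hom C D A" "v \<in> Hom C D B" for D u v
    using assms(3)[OF that] assms(4) by (metis (no_types, lifting))
  then show ?thesis
    using assms(1,2) Hom_cod_obj unfolding is_product_def by blast
qed

lemma product_homs:
  assumes "is_product C A B (P, p, q)"
  shows "p \<in> Hom C P A" "q \<in> Hom C P B"
  using assms unfolding is_product_def by auto

lemma product_lift:
  assumes "is_product C A B (P, p, q)" "u \<in> Hom C D A" "v \<in> Hom C D B"
  shows "\<exists>w \<in> Hom C D P. p \<cdot> w = u \<and> q \<cdot> w = v"
  using assms unfolding is_product_def by blast

lemma product_ext:
  assumes pr: "is_product C A B (P, p, q)" and w: "w \<in> Hom C D P" "w' \<in> Hom C D P"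
    and eq: "p \<cdot> w = p \<cdot> w'" "q \<cdot> w = q \<cdot> w'"
  shows "w = w'"
proof -
  have "p \<cdot> w \<in> Hom C D A" "q \<cdot> w \<in> Hom C D B"
    using comp_hom product_homs[OF pr] w by blast+
  then have "\<exists>!x. x \<in> Hom C D P \<and> p \<cdot> x = p \<cdot> w \<and> q \<cdot> x = q \<cdot> w"
    using pr unfolding is_product_def by blast
  then show ?thesis using w eq by metis
qed

lemma product_unique:
  assumes pr: "is_product C A B (P, p, q)" and pr': "is_product C A B (P', p', q')"
  obtains e where "is_iso C e" "e \<in> Hom C P' P" "p \<cdot> e = p'" "q \<cdot> e = q'"
proof -
  note h = product_homs[OF pr] and h' = product_homs[OF pr']
  obtain e where e: "e \<in> Hom C P' P" "p \<cdot> e = p'" "q \<cdot> e = q'"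
    using product_lift[OF pr h'] by blast
  obtain d where d: "d \<in> Hom C P P'" "p' \<cdot> d = p" "q' \<cdot> d = q"
    using product_lift[OF pr' h] by blast
  have "is_iso C e"
    using jointly_monic_iso[OF h h' product_ext[OF pr] product_ext[OF pr'] e d] .
  then show thesis using that e by blast
qed

lemma terminal_eq:
  assumes "is_terminal C T" "f \<in> Hom C A T" "g \<in> Hom C A T"
  shows "f = g"
  using assms Hom_dom_obj unfolding is_terminal_def by blast

text \<open>Over a terminal object every square commutes. One direction yields binary products from
  the pullback axiom, the other lets a given product be treated as a pullback, so that its
  projections inherit stability properties.\<close>

lemma pullback_over_terminal:
  assumes T: "is_terminal C T" and f: "f \<in> Hom C A T" and g: "g \<in> Hom C B T"
  shows "is_pullback C f g p q \<longleftrightarrow> is_product C A B (Dom C p, p, q) \<and> Dom C q = Dom C p"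
proof
  assume pb: "is_pullback C f g p q"
  have [simp]: "Dom C f = A" "Dom C g = B" using f g by (auto simp: in_Hom)
  note h = pullback_homs[OF pb, simplified]
  have "is_product C A B (Dom C p, p, q)"
  proof (rule productI[OF h(3,4)])
    fix D u v assume uv: "u \<in> Hom C D A" "v \<in> Hom C D B"
    have "f \<cdot> u = g \<cdot> v"
      by (rule terminal_eq[OF T comp_hom[OF uv(1) f] comp_hom[OF uv(2) g]])
    then show "\<exists>w \<in> Hom C D (Dom C p). p \<cdot> w = u \<and> q \<cdot> w = v"
      using pullback_lift[OF pb] uv by simp
  qed (rule pullback_ext[OF pb])
  then show "is_product C A B (Dom C p, p, q) \<and> Dom C q = Dom C p"
    using h by (auto simp: in_Hom)
next
  assume "is_product C A B (Dom C p, p, q) \<and> Dom C q = Dom C p"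
  then have pr: "is_product C A B (Dom C p, p, q)" by blast
  note h = product_homs[OF pr]
  show "is_pullback C f g p q"
  proof (rule pullbackI[OF f g h])
    show "f \<cdot> p = g \<cdot> q"
      by (rule terminal_eq[OF T comp_hom[OF h(1) f] comp_hom[OF h(2) g]])
  qed (use product_lift[OF pr] product_ext[OF pr] in blast)+
qed

end

text \<open>Isolated from path categories because it is instantiated twice: for \<open>C\<close>,
  and for \<open>Ex_cat C\<close> at a stage where the latter is not yet known to be a path category
  but pairing, diagonal and components must already be computed in it.\<close>

locale category_with_products = category +
  assumes has_products: "\<lbrakk>A \<in> Obj C; B \<in> Obj C\<rbrakk> \<Longrightarrow> \<exists>c. is_product C A B c"
begin

lemma chosen_product:
  assumes "A \<in> Obj C" "B \<in> Obj C"
  shows "is_product C A B (prod_obj C A B, proj1 C A B, proj2 C A B)"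
  using someI_ex[OF has_products[OF assms]]
  unfolding prod_cone_def prod_obj_def proj1_def proj2_def by simp

lemma proj1_hom: "\<lbrakk>A \<in> Obj C; B \<in> Obj C\<rbrakk> \<Longrightarrow> proj1 C A B \<in> Hom C (prod_obj C A B) A"
  and proj2_hom: "\<lbrakk>A \<in> Obj C; B \<in> Obj C\<rbrakk> \<Longrightarrow> proj2 C A B \<in> Hom C (prod_obj C A B) B"
  using product_homs[OF chosen_product] by blast+

lemma prod_eqI:
  assumes "w \<in> Hom C D (prod_obj C A B)" "w' \<in> Hom C D (prod_obj C A B)"
    and "A \<in> Obj C" "B \<in> Obj C"
    and "proj1 C A B \<cdot> w = proj1 C A B \<cdot> w'" "proj2 C A B \<cdot> w = proj2 C A B \<cdot> w'"
  shows "w = w'"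
  using product_ext[OF chosen_product] assms by metis

section \<open>Pairing, diagonal and components for the chosen products\<close>

lemma pairing:
  assumes f: "f \<in> Hom C D A" and g: "g \<in> Hom C D B"
  shows "pairing C f g \<in> Hom C D (prod_obj C A B)"
    and "proj1 C A B \<cdot> pairing C f g = f"
    and "proj2 C A B \<cdot> pairing C f g = g"
proof -
  have obj: "A \<in> Obj C" "B \<in> Obj C" using Hom_cod_obj f g by blast+
  have [simp]: "Dom C f = D" "Cod C f = A" "Cod C g = B" using f g by (auto simp: in_Hom)
  obtain w where w: "w \<in> Hom C D (prod_obj C A B)"
    "proj1 C A B \<cdot> w = f" "proj2 C A B \<cdot> w = g"
    using product_lift[OF chosen_product[OF obj] f g] by blast
  then have "pairing C f g = w"
    unfolding pairing_def using prod_eqI[OF _ _ obj] by (auto intro!: the_equality)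
  with w show "pairing C f g \<in> Hom C D (prod_obj C A B)"
    "proj1 C A B \<cdot> pairing C f g = f" "proj2 C A B \<cdot> pairing C f g = g" by auto
qed

lemma diag:
  assumes "A \<in> Obj C"
  shows "diag C A \<in> Hom C A (prod_obj C A A)"
    and "proj1 C A A \<cdot> diag C A = \<one> A"
    and "proj2 C A A \<cdot> diag C A = \<one> A"
  unfolding diag_def using pairing ident_hom assms by blast+

lemma prod_map:
  assumes "f \<in> Hom C A A'" "g \<in> Hom C B B'"
  shows "prod_map C f g \<in> Hom C (prod_obj C A B) (prod_obj C A' B')"
    and "proj1 C A' B' \<cdot> prod_map C f g = f \<cdot> proj1 C A B"
    and "proj2 C A' B' \<cdot> prod_map C f g = g \<cdot> proj2 C A B"
proof -
  have *: "Dom C f = A" "Dom C g = B" using assms by (auto simp: in_Hom)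
  have "f \<cdot> proj1 C A B \<in> Hom C (prod_obj C A B) A'" "g \<cdot> proj2 C A B \<in> Hom C (prod_obj C A B) B'"
    using comp_hom proj1_hom proj2_hom Hom_dom_obj assms by meson+
  from pairing[OF this] show "prod_map C f g \<in> Hom C (prod_obj C A B) (prod_obj C A' B')"
    "proj1 C A' B' \<cdot> prod_map C f g = f \<cdot> proj1 C A B"
    "proj2 C A' B' \<cdot> prod_map C f g = g \<cdot> proj2 C A B"
    unfolding prod_map_def * by auto
qed

lemma comp1_hom: "\<lbrakk>X \<in> Obj C; p \<in> Hom C R (prod_obj C X X)\<rbrakk> \<Longrightarrow> comp1 C X p \<in> Hom C R X"
  and comp2_hom: "\<lbrakk>X \<in> Obj C; p \<in> Hom C R (prod_obj C X X)\<rbrakk> \<Longrightarrow> comp2 C X p \<in> Hom C R X"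
  unfolding comp1_def comp2_def using proj1_hom proj2_hom comp_hom by blast+

lemma comp1_comp:
  "\<lbrakk>X \<in> Obj C; p \<in> Hom C R (prod_obj C X X); h \<in> Hom C D R\<rbrakk>
    \<Longrightarrow> comp1 C X (p \<cdot> h) = comp1 C X p \<cdot> h"
  and comp2_comp:
  "\<lbrakk>X \<in> Obj C; p \<in> Hom C R (prod_obj C X X); h \<in> Hom C D R\<rbrakk>
    \<Longrightarrow> comp2 C X (p \<cdot> h) = comp2 C X p \<cdot> h"
  unfolding comp1_def comp2_def
  using comp_assoc[OF _ _ proj1_hom] comp_assoc[OF _ _ proj2_hom] by metis+

lemma comp_eqI:
  assumes "X \<in> Obj C" "w \<in> Hom C D (prod_obj C X X)" "w' \<in> Hom C D (prod_obj C X X)"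
    and "comp1 C X w = comp1 C X w'" "comp2 C X w = comp2 C X w'"
  shows "w = w'"
  using prod_eqI assms unfolding comp1_def comp2_def by metis

lemma comp_pairing:
  assumes "f \<in> Hom C D X" "g \<in> Hom C D X"
  shows "comp1 C X (pairing C f g) = f" "comp2 C X (pairing C f g) = g"
  unfolding comp1_def comp2_def using pairing assms by blast+

lemma comp_diag:
  assumes "X \<in> Obj C"
  shows "comp1 C X (diag C X) = \<one> X" "comp2 C X (diag C X) = \<one> X"
  unfolding comp1_def comp2_def using diag assms by blast+

lemma comp_prod_map:
  assumes f: "f \<in> Hom C X Y" and p: "p \<in> Hom C R (prod_obj C X X)"
  shows "comp1 C Y (prod_map C f f \<cdot> p) = f \<cdot> comp1 C X p"
    "comp2 C Y (prod_map C f f \<cdot> p) = f \<cdot> comp2 C X p"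
proof -
  have obj: "X \<in> Obj C" "Y \<in> Obj C" using Hom_dom_obj Hom_cod_obj f by blast+
  note m = prod_map[OF f f]
  show "comp1 C Y (prod_map C f f \<cdot> p) = f \<cdot> comp1 C X p"
    unfolding comp1_def
    using m comp_assoc[OF p m(1) proj1_hom] comp_assoc[OF p proj1_hom f] obj by simp
  show "comp2 C Y (prod_map C f f \<cdot> p) = f \<cdot> comp2 C X p"
    unfolding comp2_def
    using m comp_assoc[OF p m(1) proj2_hom] comp_assoc[OF p proj2_hom f] obj by simp
qed

end

text \<open>Inverse image in terms of generalised elements: if \<open>f\<close> is viewed as a
  predicate on its codomain, \<open>q\<close> is the predicate obtained by substituting along
  \<open>g\<close>. Only existence of the factorisation matters, so \<open>f\<close> need not be
  monic.\<close>

lemma (in category) pullback_factors_iff: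
  assumes pb: "is_pullback C f g p q" and x: "x \<in> Hom C D (Dom C g)"
  shows "(\<exists>h \<in> Hom C D (Dom C q). q \<cdot> h = x) \<longleftrightarrow> (\<exists>h \<in> Hom C D (Dom C f). f \<cdot> h = g \<cdot> x)"
proof -
  note hs = pullback_homs[OF pb]
  have [simp]: "Dom C q = Dom C p" using hs by (simp add: in_Hom)
  show ?thesis
  proof safe
    fix h assume h: "h \<in> Hom C D (Dom C q)" and x: "x = q \<cdot> h"
    then have h: "h \<in> Hom C D (Dom C p)" by simp
    have "f \<cdot> p \<cdot> h = g \<cdot> q \<cdot> h"
      using comp_assoc[OF h hs(3,1)] comp_assoc[OF h hs(4,2)] hs(5) by simp
    then show "\<exists>h' \<in> Hom C D (Dom C f). f \<cdot> h' = g \<cdot> q \<cdot> h"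
      using comp_hom[OF h hs(3)] by blast
  next
    fix h assume "h \<in> Hom C D (Dom C f)" "f \<cdot> h = g \<cdot> x"
    then show "\<exists>h \<in> Hom C D (Dom C q). q \<cdot> h = x"
      using pullback_lift[OF pb _ x] by auto
  qed
qed

lemma (in category_with_products) prod_map_pairing:
  assumes f: "f \<in> Hom C X Y" and u: "u \<in> Hom C D X" and v: "v \<in> Hom C D X"
  shows "prod_map C f f \<cdot> pairing C u v = pairing C (f \<cdot> u) (f \<cdot> v)"
proof (rule comp_eqI)
  note fu = comp_hom[OF u f] and fv = comp_hom[OF v f]
  show "Y \<in> Obj C" using f Hom_cod_obj by blast
  show "prod_map C f f \<cdot> pairing C u v \<in> Hom C D (prod_obj C Y Y)"
    using comp_hom[OF pairing(1)[OF u v] prod_map(1)[OF f f]] .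
  show "pairing C (f \<cdot> u) (f \<cdot> v) \<in> Hom C D (prod_obj C Y Y)"
    using pairing(1)[OF fu fv] .
  show "comp1 C Y (prod_map C f f \<cdot> pairing C u v) = comp1 C Y (pairing C (f \<cdot> u) (f \<cdot> v))"
    "comp2 C Y (prod_map C f f \<cdot> pairing C u v) = comp2 C Y (pairing C (f \<cdot> u) (f \<cdot> v))"
    using comp_prod_map[OF f pairing(1)[OF u v]] comp_pairing[OF u v] comp_pairing[OF fu fv]
    by simp_all
qed

section \<open>Fibrant relations and generalised elements\<close>

text \<open>A fibration \<open>R \<rightarrow> X \<times> X\<close> is treated as a binary relation on the generalised elements
  \<open>D \<rightarrow> X\<close>; the pair \<open>A\<close> below stands for \<open>(X, R \<rightarrow> X \<times> X)\<close>.\<close>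

definition related :: "('o, 'm, 'z) category_scheme \<Rightarrow> 'o \<times> 'm \<Rightarrow> 'm \<Rightarrow> 'm \<Rightarrow> bool" where
  "related C A u v \<longleftrightarrow>
     (\<exists>h \<in> Hom C (Dom C u) (Dom C (snd A)).
        comp1 C (fst A) (snd A) \<cdot>\<^bsub>C\<^esub> h = u \<and> comp2 C (fst A) (snd A) \<cdot>\<^bsub>C\<^esub> h = v)"

text \<open>The notion without the three equivalence axioms, so that inverse images and
  intersections can be formed before these axioms are checked for them.\<close>

definition fibrant_relation :: "('o, 'm, 'z) path_structure_scheme \<Rightarrow> 'o \<times> 'm \<Rightarrow> bool" where
  "fibrant_relation C A \<longleftrightarrow>
     fst A \<in> Obj C \<and> snd A \<in> Fib C \<and> snd A \<in> Hom C (Dom C (snd A)) (prod_obj C (fst A) (fst A))"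

sublocale path_category \<subseteq> category_with_products
proof
  fix A B assume AB: "A \<in> Obj C" "B \<in> Obj C"
  obtain T where T: "is_terminal C T" "\<And>X. X \<in> Obj C \<Longrightarrow> Hom C X T \<subseteq> Fib C"
    using terminal by blast
  obtain f g where fg: "f \<in> Hom C A T" "g \<in> Hom C B T"
    using T(1) AB unfolding is_terminal_def by blast
  then have "f \<in> Fib C" "g \<in> Arr C" "Cod C g = Cod C f"
    using T(2)[OF AB(1)] by (blast, simp_all add: in_Hom)
  then obtain p q where "is_pullback C f g p q" using pullback_exists by blast
  then show "\<exists>c. is_product C A B c"
    using pullback_over_terminal[OF T(1) fg] by blast
qed

context path_category
begin

text \<open>Each projection is a pullback of the arrow from the other factor to the terminal object,
  which is a fibration by axiom.\<close>

lemma product_projections_fib: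
  assumes pr: "is_product C A B (P, p, q)"
  shows "p \<in> Fib C" "q \<in> Fib C"
proof -
  have AB: "A \<in> Obj C" "B \<in> Obj C" using pr unfolding is_product_def by auto
  obtain T where T: "is_terminal C T" "\<And>X. X \<in> Obj C \<Longrightarrow> Hom C X T \<subseteq> Fib C"
    using terminal by blast
  obtain f g where fg: "f \<in> Hom C A T" "g \<in> Hom C B T"
    using T(1) AB unfolding is_terminal_def by blast
  have fib: "f \<in> Fib C" "g \<in> Fib C" using T(2) AB fg by auto
  have "Dom C p = P" "Dom C q = P" using product_homs[OF pr] by (auto simp: in_Hom)
  then have pb: "is_pullback C f g p q"
    using pullback_over_terminal[OF T(1) fg] pr by simp
  show "q \<in> Fib C" by (rule pullback_fib[OF fib(1) pb])
  show "p \<in> Fib C" by (rule pullback_fib[OF fib(2) pullback_commute[OF pb]])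
qed

abbreviation Rel where "Rel A \<equiv> Dom C (snd A)"
abbreviation src where "src A \<equiv> comp1 C (fst A) (snd A)"
abbreviation tgt where "tgt A \<equiv> comp2 C (fst A) (snd A)"

lemma fibrant_relation_homs:
  assumes "fibrant_relation C A"
  shows "fst A \<in> Obj C" "snd A \<in> Hom C (Rel A) (prod_obj C (fst A) (fst A))"
    "src A \<in> Hom C (Rel A) (fst A)" "tgt A \<in> Hom C (Rel A) (fst A)" "Rel A \<in> Obj C"
  using assms comp1_hom comp2_hom Hom_dom_obj unfolding fibrant_relation_def by blast+

lemma fibrant_relation_fibs:
  assumes "fibrant_relation C A"
  shows "snd A \<in> Fib C" "src A \<in> Fib C" "tgt A \<in> Fib C"
proof -
  note h = fibrant_relation_homs[OF assms]
  show *: "snd A \<in> Fib C" using assms unfolding fibrant_relation_def by blast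
  have "Cod C (snd A) = prod_obj C (fst A) (fst A)"
    "Dom C (proj1 C (fst A) (fst A)) = prod_obj C (fst A) (fst A)"
    "Dom C (proj2 C (fst A) (fst A)) = prod_obj C (fst A) (fst A)"
    using h(2) proj1_hom[OF h(1) h(1)] proj2_hom[OF h(1) h(1)] by (auto simp: in_Hom)
  then show "src A \<in> Fib C" "tgt A \<in> Fib C"
    unfolding comp1_def comp2_def
    using fib_comp[OF *] product_projections_fib[OF chosen_product[OF h(1) h(1)]] by simp_all
qed

lemma relatedI:
  assumes "h \<in> Hom C D (Rel A)" "u \<in> Hom C D X" "src A \<cdot> h = u" "tgt A \<cdot> h = v"
  shows "related C A u v"
  using assms unfolding related_def by (auto simp: in_Hom)

lemma relatedE:
  assumes "related C A u v" "u \<in> Hom C D X"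
  obtains h where "h \<in> Hom C D (Rel A)" "src A \<cdot> h = u" "tgt A \<cdot> h = v"
  using assms unfolding related_def by (auto simp: in_Hom)

text \<open>The universal related pair, witnessed by the identity of \<open>R\<close>: every related
  pair arises from it by precomposition with a witness. Evaluating a property of related pairs here
  recovers an arrow out of \<open>R\<close>.\<close>

lemma related_generic:
  assumes "fibrant_relation C A"
  shows "related C A (src A) (tgt A)"
  using fibrant_relation_homs[OF assms] ident_hom ident_right relatedI by metis

lemma related_precomp:
  assumes A: "fibrant_relation C A" and r: "related C A u v"
    and u: "u \<in> Hom C D X" and k: "k \<in> Hom C E D"
  shows "related C A (u \<cdot> k) (v \<cdot> k)"
proof -
  note hs = fibrant_relation_homs[OF A]
  obtain h where h: "h \<in> Hom C D (Rel A)" "src A \<cdot> h = u" "tgt A \<cdot> h = v"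
    using relatedE[OF r u] .
  show ?thesis
    using relatedI[OF comp_hom[OF k h(1)] comp_hom[OF k u]]
      comp_assoc[OF k h(1) hs(3)] comp_assoc[OF k h(1) hs(4)] h by simp
qed

lemma related_iff_pairing:
  assumes A: "fibrant_relation C A" and u: "u \<in> Hom C D (fst A)" and v: "v \<in> Hom C D (fst A)"
  shows "related C A u v \<longleftrightarrow> (\<exists>h \<in> Hom C D (Rel A). snd A \<cdot> h = pairing C u v)"
proof -
  note hs = fibrant_relation_homs[OF A]
  have "src A \<cdot> h = u \<and> tgt A \<cdot> h = v \<longleftrightarrow> snd A \<cdot> h = pairing C u v"
    if h: "h \<in> Hom C D (Rel A)" for h
    using comp1_comp[OF hs(1,2) h] comp2_comp[OF hs(1,2) h] comp_pairing[OF u v]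
      comp_eqI[OF hs(1) comp_hom[OF h hs(2)] pairing(1)[OF u v]] by auto
  moreover have "Dom C u = D" using u by (simp add: in_Hom)
  ultimately show ?thesis unfolding related_def by auto
qed

section \<open>Homotopy equivalence relations as equivalence relations on generalised
  elements\<close>

lemma her_fibrant: "A \<in> her_objects C \<Longrightarrow> fibrant_relation C A"
  unfolding her_objects_def homotopy_equivalence_relation_def fibrant_relation_def Let_def by auto

lemma her_refl:
  assumes A: "A \<in> her_objects C" and u: "u \<in> Hom C D (fst A)"
  shows "related C A u u"
proof -
  note hs = fibrant_relation_homs[OF her_fibrant[OF A]]
  obtain r where r: "r \<in> Hom C (fst A) (Rel A)" "snd A \<cdot> r = diag C (fst A)"
    using A unfolding her_objects_def homotopy_equivalence_relation_def Let_def by auto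
  have "src A \<cdot> r = \<one> (fst A)" "tgt A \<cdot> r = \<one> (fst A)"
    using comp1_comp[OF hs(1,2) r(1)] comp2_comp[OF hs(1,2) r(1)] r(2) comp_diag[OF hs(1)] by auto
  then show ?thesis
    using relatedI[OF comp_hom[OF u r(1)] u]
      comp_assoc[OF u r(1) hs(3)] comp_assoc[OF u r(1) hs(4)] ident_left[OF u] by simp
qed

lemma her_sym:
  assumes A: "A \<in> her_objects C" and r: "related C A u v"
    and u: "u \<in> Hom C D (fst A)" and v: "v \<in> Hom C D (fst A)"
  shows "related C A v u"
proof -
  note hs = fibrant_relation_homs[OF her_fibrant[OF A]]
  obtain s where s: "s \<in> Hom C (Rel A) (Rel A)" "src A \<cdot> s = tgt A" "tgt A \<cdot> s = src A"
    using A unfolding her_objects_def homotopy_equivalence_relation_def Let_def by auto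
  obtain h where h: "h \<in> Hom C D (Rel A)" "src A \<cdot> h = u" "tgt A \<cdot> h = v"
    using relatedE[OF r u] .
  show ?thesis
    using relatedI[OF comp_hom[OF h(1) s(1)] v]
      comp_assoc[OF h(1) s(1) hs(3)] comp_assoc[OF h(1) s(1) hs(4)] s h by simp
qed

text \<open>Witnesses for the two related pairs agree at \<open>v\<close>, so together they form a
  single arrow into the pullback of the two legs of \<open>R\<close>, where the internal
  transitivity map is defined.\<close>

lemma her_trans:
  assumes A: "A \<in> her_objects C" and r: "related C A u v" "related C A v w"
    and u: "u \<in> Hom C D (fst A)" and v: "v \<in> Hom C D (fst A)"
  shows "related C A u w"
proof -
  note hs = fibrant_relation_homs[OF her_fibrant[OF A]]
  obtain q1 q2 t where pb: "is_pullback C (tgt A) (src A) q1 q2"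
    and t: "t \<in> Hom C (Dom C q1) (Rel A)" "src A \<cdot> t = src A \<cdot> q1" "tgt A \<cdot> t = tgt A \<cdot> q2"
    using A unfolding her_objects_def homotopy_equivalence_relation_def Let_def by auto
  obtain h where h: "h \<in> Hom C D (Rel A)" "src A \<cdot> h = u" "tgt A \<cdot> h = v"
    using relatedE[OF r(1) u] .
  obtain k where k: "k \<in> Hom C D (Rel A)" "src A \<cdot> k = v" "tgt A \<cdot> k = w"
    using relatedE[OF r(2) v] .
  have d: "Dom C (tgt A) = Rel A" "Dom C (src A) = Rel A" using hs by (auto simp: in_Hom)
  obtain l where l: "l \<in> Hom C D (Dom C q1)" "q1 \<cdot> l = h" "q2 \<cdot> l = k"
    using pullback_lift[OF pb] h k d by metis
  have q: "q1 \<in> Hom C (Dom C q1) (Rel A)" "q2 \<in> Hom C (Dom C q1) (Rel A)"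
    using pullback_homs[OF pb] d by simp_all
  show ?thesis
    using relatedI[OF comp_hom[OF l(1) t(1)] u]
      comp_assoc[OF l(1) t(1) hs(3)] comp_assoc[OF l(1) t(1) hs(4)] t
      comp_assoc[OF l(1) q(1) hs(3)] comp_assoc[OF l(1) q(2) hs(4)] l h k by simp
qed

text \<open>The internal witnesses are read off from universal instances: reflexivity at the
  identity of \<open>X\<close>, symmetry at the generic related pair, transitivity at the generic
  composable pair over the pullback of the two legs.\<close>

lemma herI:
  assumes A: "fibrant_relation C A"
    and refl: "\<And>D u. u \<in> Hom C D (fst A) \<Longrightarrow> related C A u u"
    and sym: "\<And>D u v. \<lbrakk>u \<in> Hom C D (fst A); v \<in> Hom C D (fst A); related C A u v\<rbrakk>
                \<Longrightarrow> related C A v u"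
    and trans: "\<And>D u v w. \<lbrakk>u \<in> Hom C D (fst A); v \<in> Hom C D (fst A); w \<in> Hom C D (fst A);
                  related C A u v; related C A v w\<rbrakk> \<Longrightarrow> related C A u w"
  shows "A \<in> her_objects C"
proof -
  note hs = fibrant_relation_homs[OF A]
  note X = ident_hom[OF hs(1)]
  have "\<exists>r \<in> Hom C (fst A) (Rel A). snd A \<cdot> r = diag C (fst A)"
    using refl[OF X] related_iff_pairing[OF A X X] unfolding diag_def by blast
  moreover have "related C A (tgt A) (src A)"
    using sym[OF hs(3,4) related_generic[OF A]] .
  then have "\<exists>s \<in> Hom C (Rel A) (Rel A). src A \<cdot> s = tgt A \<and> tgt A \<cdot> s = src A"
    using relatedE[OF _ hs(4)] by metis
  moreover have "\<exists>q1 q2. is_pullback C (tgt A) (src A) q1 q2 \<and>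
     (\<exists>t \<in> Hom C (Dom C q1) (Rel A). src A \<cdot> t = src A \<cdot> q1 \<and> tgt A \<cdot> t = tgt A \<cdot> q2)"
  proof -
    have "src A \<in> Arr C" "Cod C (src A) = Cod C (tgt A)" using hs by (auto simp: in_Hom)
    then obtain q1 q2 where pb: "is_pullback C (tgt A) (src A) q1 q2"
      using pullback_exists[OF fibrant_relation_fibs(3)[OF A]] by blast
    have d: "Dom C (tgt A) = Rel A" "Dom C (src A) = Rel A" using hs by (auto simp: in_Hom)
    have q: "q1 \<in> Hom C (Dom C q1) (Rel A)" "q2 \<in> Hom C (Dom C q1) (Rel A)"
      "tgt A \<cdot> q1 = src A \<cdot> q2"
      using pullback_homs[OF pb] d by simp_all
    note g = related_precomp[OF A related_generic[OF A] hs(3)]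
    \<comment> \<open>The generic composable pair: \<open>src q1 ~ tgt q1 = src q2 ~ tgt q2\<close>,
      the middle equality being the pullback square.\<close>
    have "related C A (src A \<cdot> q1) (tgt A \<cdot> q2)"
      using trans[OF comp_hom[OF q(1) hs(3)] comp_hom[OF q(1) hs(4)] comp_hom[OF q(2) hs(4)]]
        g[OF q(1)] g[OF q(2)] q(3) by simp
    then show ?thesis using pb relatedE[OF _ comp_hom[OF q(1) hs(3)]] by metis
  qed
  ultimately show ?thesis
    using A unfolding her_objects_def homotopy_equivalence_relation_def fibrant_relation_def Let_def
    by (cases A) simp
qed

section \<open>Relations by inverse image and intersection\<close>

lemma inverse_image_relation:
  assumes B: "fibrant_relation C B" and f: "f \<in> Hom C X (fst B)"
  obtains r where "fibrant_relation C (X, r)"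
    "\<And>D u v. \<lbrakk>u \<in> Hom C D X; v \<in> Hom C D X\<rbrakk>
       \<Longrightarrow> related C (X, r) u v \<longleftrightarrow> related C B (f \<cdot> u) (f \<cdot> v)"
proof -
  note hs = fibrant_relation_homs[OF B] and m = prod_map(1)[OF f f]
  have "prod_map C f f \<in> Arr C" "Cod C (prod_map C f f) = Cod C (snd B)"
    using hs m by (auto simp: in_Hom)
  \<comment> \<open>The new relation is the leg \<open>q\<close> of the pullback of \<open>R\<close>
    along \<open>f\<close> x \<open>f\<close>; as a pullback of a fibration it is again a
    fibration.\<close>
  then obtain p q where pb: "is_pullback C (snd B) (prod_map C f f) p q"
    using pullback_exists[OF fibrant_relation_fibs(1)[OF B]] by blast
  have d: "Dom C (prod_map C f f) = prod_obj C X X" using m by (simp add: in_Hom)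
  have "q \<in> Hom C (Dom C q) (prod_obj C X X)"
    using pullback_homs[OF pb] d by (auto simp: in_Hom)
  then have fr: "fibrant_relation C (X, q)"
    unfolding fibrant_relation_def
    using pullback_fib[OF fibrant_relation_fibs(1)[OF B] pb] Hom_dom_obj[OF f] by simp
  show thesis
  proof (rule that[OF fr])
    fix D u v assume u: "u \<in> Hom C D X" and v: "v \<in> Hom C D X"
    have x: "pairing C u v \<in> Hom C D (Dom C (prod_map C f f))"
      using pairing(1)[OF u v] d by simp
    show "related C (X, q) u v \<longleftrightarrow> related C B (f \<cdot> u) (f \<cdot> v)"
      using related_iff_pairing[OF fr, of u D v] u v
        related_iff_pairing[OF B comp_hom[OF u f] comp_hom[OF v f]]
        pullback_factors_iff[OF pb x] prod_map_pairing[OF f u v] by simp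
  qed
qed

text \<open>The intersection is the diagonal of the pullback square of \<open>a\<close> and
  \<open>b\<close>: its projection to the domain of \<open>a\<close> is a pullback of
  \<open>b\<close>, so composing it with \<open>a\<close> stays among the fibrations.\<close>

lemma intersection_relation:
  assumes A: "fibrant_relation C (X, a)" and B: "fibrant_relation C (X, b)"
  obtains r where "fibrant_relation C (X, r)"
    "\<And>D u v. \<lbrakk>u \<in> Hom C D X; v \<in> Hom C D X\<rbrakk>
       \<Longrightarrow> related C (X, r) u v \<longleftrightarrow> related C (X, a) u v \<and> related C (X, b) u v"
proof -
  note hA = fibrant_relation_homs[OF A, simplified] and hB = fibrant_relation_homs[OF B, simplified]
  note fA = fibrant_relation_fibs(1)[OF A, simplified]
    and fB = fibrant_relation_fibs(1)[OF B, simplified]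
  have "b \<in> Arr C" "Cod C b = Cod C a" using hA hB by (auto simp: in_Hom)
  then obtain p q where pb: "is_pullback C a b p q" using pullback_exists[OF fA] by blast
  have p: "p \<in> Hom C (Dom C p) (Dom C a)" and q: "q \<in> Hom C (Dom C p) (Dom C b)"
    and eq: "a \<cdot> p = b \<cdot> q" using pullback_homs[OF pb] by auto
  note ap = comp_hom[OF p hA(2)]
  have d: "Dom C (a \<cdot> p) = Dom C p" "Cod C p = Dom C a" using ap p by (auto simp: in_Hom)
  have fr: "fibrant_relation C (X, a \<cdot> p)"
    using fib_comp[OF pullback_fib[OF fB pullback_commute[OF pb]] fA] ap d hA(1)
    unfolding fibrant_relation_def by simp
  show thesis
  proof (rule that[OF fr])
    fix D u v assume u: "u \<in> Hom C D X" and v: "v \<in> Hom C D X"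
    let ?x = "pairing C u v"
    have "(\<exists>h \<in> Hom C D (Dom C p). (a \<cdot> p) \<cdot> h = ?x) \<longleftrightarrow>
      (\<exists>h \<in> Hom C D (Dom C a). a \<cdot> h = ?x) \<and> (\<exists>h \<in> Hom C D (Dom C b). b \<cdot> h = ?x)"
    proof safe
      fix h assume h: "h \<in> Hom C D (Dom C p)" and x: "(a \<cdot> p) \<cdot> h = ?x"
      have "a \<cdot> (p \<cdot> h) = ?x" "b \<cdot> (q \<cdot> h) = ?x"
        using x eq comp_assoc[OF h p hA(2)] comp_assoc[OF h q hB(2)] by simp_all
      then show "\<exists>h \<in> Hom C D (Dom C a). a \<cdot> h = ?x" "\<exists>h \<in> Hom C D (Dom C b). b \<cdot> h = ?x"
        using comp_hom[OF h p] comp_hom[OF h q] by blast+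
    next
      fix h k assume h: "h \<in> Hom C D (Dom C a)" "a \<cdot> h = ?x"
        and k: "k \<in> Hom C D (Dom C b)" "b \<cdot> k = ?x"
      then obtain l where l: "l \<in> Hom C D (Dom C p)" "p \<cdot> l = h"
        using pullback_lift[OF pb] by metis
      then show "\<exists>h \<in> Hom C D (Dom C p). (a \<cdot> p) \<cdot> h = ?x"
        using comp_assoc[OF l(1) p hA(2)] h by auto
    qed
    then show "related C (X, a \<cdot> p) u v \<longleftrightarrow> related C (X, a) u v \<and> related C (X, b) u v"
      using related_iff_pairing[OF fr, of u D v] related_iff_pairing[OF A, of u D v]
        related_iff_pairing[OF B, of u D v] u v d by simp
  qed
qed

text \<open>A single construction for pullbacks, products and path objects of Ex. Once the relation
  is described on elements, the equivalence axioms pass from \<open>A\<close> and \<open>B\<close>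
  to it pointwise.\<close>

lemma joint_inverse_image_her:
  assumes A: "A \<in> her_objects C" and B: "B \<in> her_objects C"
    and f: "f \<in> Hom C Z (fst A)" and g: "g \<in> Hom C Z (fst B)"
  obtains r where "(Z, r) \<in> her_objects C"
    "\<And>D u v. \<lbrakk>u \<in> Hom C D Z; v \<in> Hom C D Z\<rbrakk>
       \<Longrightarrow> related C (Z, r) u v \<longleftrightarrow> related C A (f \<cdot> u) (f \<cdot> v) \<and> related C B (g \<cdot> u) (g \<cdot> v)"
proof -
  obtain a where a: "fibrant_relation C (Z, a)"
    "\<And>D u v. \<lbrakk>u \<in> Hom C D Z; v \<in> Hom C D Z\<rbrakk>
       \<Longrightarrow> related C (Z, a) u v \<longleftrightarrow> related C A (f \<cdot> u) (f \<cdot> v)"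
    using inverse_image_relation[OF her_fibrant[OF A] f] by blast
  obtain b where b: "fibrant_relation C (Z, b)"
    "\<And>D u v. \<lbrakk>u \<in> Hom C D Z; v \<in> Hom C D Z\<rbrakk>
       \<Longrightarrow> related C (Z, b) u v \<longleftrightarrow> related C B (g \<cdot> u) (g \<cdot> v)"
    using inverse_image_relation[OF her_fibrant[OF B] g] by blast
  obtain r where r: "fibrant_relation C (Z, r)"
    "\<And>D u v. \<lbrakk>u \<in> Hom C D Z; v \<in> Hom C D Z\<rbrakk>
       \<Longrightarrow> related C (Z, r) u v \<longleftrightarrow> related C (Z, a) u v \<and> related C (Z, b) u v"
    using intersection_relation[OF a(1) b(1)] by blast
  have rel: "related C (Z, r) u v \<longleftrightarrow> related C A (f \<cdot> u) (f \<cdot> v) \<and> related C B (g \<cdot> u) (g \<cdot> v)"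
    if "u \<in> Hom C D Z" "v \<in> Hom C D Z" for D u v
    using r(2) a(2) b(2) that by blast
  have "(Z, r) \<in> her_objects C"
  proof (rule herI[OF r(1)], unfold fst_conv)
    fix D u assume u: "u \<in> Hom C D Z"
    note u' = comp_hom[OF u f] comp_hom[OF u g]
    show "related C (Z, r) u u" using rel[OF u u] her_refl[OF A] her_refl[OF B] u' by blast
    fix v assume v: "v \<in> Hom C D Z"
    note v' = comp_hom[OF v f] comp_hom[OF v g]
    show "related C (Z, r) v u" if "related C (Z, r) u v"
      using that rel[OF u v] rel[OF v u] her_sym[OF A] her_sym[OF B] u' v' by blast
    fix w assume w: "w \<in> Hom C D Z"
    show "related C (Z, r) u w" if "related C (Z, r) u v" "related C (Z, r) v w"
      using that rel[OF u v] rel[OF v w] rel[OF u w] her_trans[OF A] her_trans[OF B] u' v' by blast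
  qed
  with rel that show thesis by blast
qed

text \<open>A tracking map carries witnesses over \<open>A\<close> to witnesses over
  \<open>B\<close> by composition. Conversely, preservation of the generic pair of \<open>A\<close>
  produces a tracking map.\<close>

lemma tracked_iff:
  assumes A: "fibrant_relation C A" and B: "fibrant_relation C B"
  shows "tracked C A B f \<longleftrightarrow> f \<in> Hom C (fst A) (fst B) \<and>
    (\<forall>D. \<forall>u \<in> Hom C D (fst A). \<forall>v \<in> Hom C D (fst A).
       related C A u v \<longrightarrow> related C B (f \<cdot> u) (f \<cdot> v))"
proof -
  note hA = fibrant_relation_homs[OF A] and hB = fibrant_relation_homs[OF B]
  have eq: "snd B \<cdot> k = prod_map C f f \<cdot> snd A \<longleftrightarrow>
      src B \<cdot> k = f \<cdot> src A \<and> tgt B \<cdot> k = f \<cdot> tgt A"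
    if f: "f \<in> Hom C (fst A) (fst B)" and k: "k \<in> Hom C (Rel A) (Rel B)" for k
    using comp1_comp[OF hB(1,2) k] comp2_comp[OF hB(1,2) k] comp_prod_map[OF f hA(2)]
      comp_eqI[OF hB(1) comp_hom[OF k hB(2)] comp_hom[OF hA(2) prod_map(1)[OF f f]]] by auto
  have t: "tracked C A B f \<longleftrightarrow> f \<in> Hom C (fst A) (fst B) \<and>
    (\<exists>k \<in> Hom C (Rel A) (Rel B). snd B \<cdot> k = prod_map C f f \<cdot> snd A)"
    by (simp add: tracked_def split_beta)
  show ?thesis
  proof safe
    assume "tracked C A B f"
    then obtain k where f: "f \<in> Hom C (fst A) (fst B)" and k: "k \<in> Hom C (Rel A) (Rel B)"
      "src B \<cdot> k = f \<cdot> src A" "tgt B \<cdot> k = f \<cdot> tgt A"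
      using t eq by blast
    show "f \<in> Hom C (fst A) (fst B)" using f .
    fix D u v assume u: "u \<in> Hom C D (fst A)" and v: "v \<in> Hom C D (fst A)" and r: "related C A u v"
    obtain h where h: "h \<in> Hom C D (Rel A)" "src A \<cdot> h = u" "tgt A \<cdot> h = v"
      using relatedE[OF r u] .
    show "related C B (f \<cdot> u) (f \<cdot> v)"
      using relatedI[OF comp_hom[OF h(1) k(1)] comp_hom[OF u f]]
        comp_assoc[OF h(1) k(1) hB(3)] comp_assoc[OF h(1) k(1) hB(4)] k h
        comp_assoc[OF h(1) hA(3) f] comp_assoc[OF h(1) hA(4) f] by simp
  next
    assume f: "f \<in> Hom C (fst A) (fst B)" and
      "\<forall>D. \<forall>u \<in> Hom C D (fst A). \<forall>v \<in> Hom C D (fst A).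
         related C A u v \<longrightarrow> related C B (f \<cdot> u) (f \<cdot> v)"
    then have r: "related C B (f \<cdot> src A) (f \<cdot> tgt A)" using hA related_generic[OF A] by blast
    show "tracked C A B f"
      using relatedE[OF r comp_hom[OF hA(3) f]] t f eq[OF f] by metis
  qed
qed

text \<open>The diagonal of a terminal object is an isomorphism, hence a fibration. As a relation it
  is equality, which is total because parallel arrows into \<open>T\<close> coincide.\<close>

lemma terminal_her:
  assumes T: "is_terminal C T"
  obtains r where "(T, r) \<in> her_objects C"
    "\<And>D u v. \<lbrakk>u \<in> Hom C D T; v \<in> Hom C D T\<rbrakk> \<Longrightarrow> related C (T, r) u v"
proof -
  have obj: "T \<in> Obj C" using T unfolding is_terminal_def by blast
  note d = diag[OF obj]
  have "diag C T \<cdot> proj1 C T T = \<one> (prod_obj C T T)"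
  proof (rule prod_eqI[OF _ _ obj obj])
    show "diag C T \<cdot> proj1 C T T \<in> Hom C (prod_obj C T T) (prod_obj C T T)"
      using comp_hom[OF proj1_hom d(1)] obj by blast
    show "\<one> (prod_obj C T T) \<in> Hom C (prod_obj C T T) (prod_obj C T T)"
      using ident_hom Hom_dom_obj proj1_hom obj by blast
  qed (use terminal_eq[OF T] comp_hom d(1) proj1_hom proj2_hom obj ident_hom Hom_dom_obj in meson)+
  then have "is_iso C (diag C T)"
    using isoI[OF d(1) proj1_hom d(2)] obj by blast
  moreover have "Dom C (diag C T) = T" using d(1) by (simp add: in_Hom)
  ultimately have fr: "fibrant_relation C (T, diag C T)"
    unfolding fibrant_relation_def using d(1) obj iso_acyclic_fib by auto
  note hs = fibrant_relation_homs[OF fr, simplified \<open>Dom C (diag C T) = T\<close> fst_conv snd_conv]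
  have rel: "related C (T, diag C T) u v" if u: "u \<in> Hom C D T" and v: "v \<in> Hom C D T" for D u v
    using relatedI[of u D "(T, diag C T)" u T v] \<open>Dom C (diag C T) = T\<close> comp_diag[OF obj]
      ident_left[OF u] terminal_eq[OF T u v] u by simp
  have "(T, diag C T) \<in> her_objects C"
    by (rule herI[OF fr]) (use rel in auto)
  with rel that show thesis by blast
qed

end

section \<open>Arrows of Ex\<close>

context path_category
begin

lemma Ex_cat_simps [simp]:
  "Obj (Ex_cat C) = her_objects C" "Arr (Ex_cat C) = Ex_arrows C"
  "Dom (Ex_cat C) (A, f, B) = A" "Cod (Ex_cat C) (A, f, B) = B"
  "Ident (Ex_cat C) A = (A, \<one> (fst A), A)"
  "(B', g, D) \<cdot>\<^bsub>Ex_cat C\<^esub> (A, f, B) = (A, g \<cdot> f, D)"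
  "Fib (Ex_cat C) = Ex_fibrations C" "Weq (Ex_cat C) = Ex_weak_equivalences C"
  by (simp_all add: Ex_cat_def)

lemma in_Ex_Hom: "F \<in> Hom (Ex_cat C) A B \<longleftrightarrow> (\<exists>f. F = (A, f, B) \<and> (A, f, B) \<in> Ex_arrows C)"
  by (cases F) (auto simp: in_Hom)

lemma Ex_arrow_iff:
  "(A, f, B) \<in> Ex_arrows C \<longleftrightarrow>
    A \<in> her_objects C \<and> B \<in> her_objects C \<and> f \<in> Hom C (fst A) (fst B) \<and>
    (\<forall>D. \<forall>u \<in> Hom C D (fst A). \<forall>v \<in> Hom C D (fst A).
       related C A u v \<longrightarrow> related C B (f \<cdot> u) (f \<cdot> v))"
proof -
  have "(A, f, B) \<in> Ex_arrows C \<longleftrightarrow> A \<in> her_objects C \<and> B \<in> her_objects C \<and> tracked C A B f"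
    by (simp add: Ex_arrows_def)
  then show ?thesis using tracked_iff[OF her_fibrant[of A] her_fibrant[of B], of f] by argo
qed

lemma Ex_arrowI:
  assumes "A \<in> her_objects C" "B \<in> her_objects C" "f \<in> Hom C (fst A) (fst B)"
    and "\<And>D u v. \<lbrakk>u \<in> Hom C D (fst A); v \<in> Hom C D (fst A); related C A u v\<rbrakk>
           \<Longrightarrow> related C B (f \<cdot> u) (f \<cdot> v)"
  shows "(A, f, B) \<in> Ex_arrows C"
  using assms unfolding Ex_arrow_iff by blast

lemma Ex_arrowD:
  assumes "(A, f, B) \<in> Ex_arrows C"
  shows "A \<in> her_objects C" "B \<in> her_objects C" "f \<in> Hom C (fst A) (fst B)"
    and "\<lbrakk>related C A u v; u \<in> Hom C D (fst A); v \<in> Hom C D (fst A)\<rbrakk>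
           \<Longrightarrow> related C B (f \<cdot> u) (f \<cdot> v)"
  using assms unfolding Ex_arrow_iff by blast+

lemma Ex_arrow_ident:
  assumes "A \<in> her_objects C"
  shows "(A, \<one> (fst A), A) \<in> Ex_arrows C"
proof (rule Ex_arrowI[OF assms assms])
  show "\<one> (fst A) \<in> Hom C (fst A) (fst A)"
    using ident_hom fibrant_relation_homs(1)[OF her_fibrant[OF assms]] .
qed (simp add: ident_left)

lemma Ex_arrow_comp:
  assumes f: "(A, f, B) \<in> Ex_arrows C" and g: "(B, g, D) \<in> Ex_arrows C"
  shows "(A, g \<cdot> f, D) \<in> Ex_arrows C"
proof (rule Ex_arrowI)
  show "A \<in> her_objects C" "D \<in> her_objects C" using f g by (auto dest: Ex_arrowD)
  note fh = Ex_arrowD(3)[OF f] and gh = Ex_arrowD(3)[OF g]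
  show "g \<cdot> f \<in> Hom C (fst A) (fst D)" using comp_hom[OF fh gh] .
  fix E u v assume u: "u \<in> Hom C E (fst A)" and v: "v \<in> Hom C E (fst A)" and r: "related C A u v"
  then have "related C D (g \<cdot> f \<cdot> u) (g \<cdot> f \<cdot> v)"
    using Ex_arrowD(4)[OF f r u v] Ex_arrowD(4)[OF g] comp_hom[OF u fh] comp_hom[OF v fh] by blast
  then show "related C D ((g \<cdot> f) \<cdot> u) ((g \<cdot> f) \<cdot> v)"
    using comp_assoc[OF u fh gh] comp_assoc[OF v fh gh] by simp
qed

lemma Ex_category: "category (Ex_cat C)"
proof
  fix A assume "A \<in> Obj (Ex_cat C)"
  then show "\<one>\<^bsub>Ex_cat C\<^esub> A \<in> Hom (Ex_cat C) A A" by (simp add: in_Ex_Hom Ex_arrow_ident)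
next
  fix F G A B D assume "F \<in> Hom (Ex_cat C) A B" "G \<in> Hom (Ex_cat C) B D"
  then show "G \<cdot>\<^bsub>Ex_cat C\<^esub> F \<in> Hom (Ex_cat C) A D"
    by (auto simp: in_Ex_Hom intro: Ex_arrow_comp)
next
  fix F A B assume "F \<in> Hom (Ex_cat C) A B"
  then show "\<one>\<^bsub>Ex_cat C\<^esub> B \<cdot>\<^bsub>Ex_cat C\<^esub> F = F" "F \<cdot>\<^bsub>Ex_cat C\<^esub> \<one>\<^bsub>Ex_cat C\<^esub> A = F"
    by (auto simp: in_Ex_Hom simp: ident_left[OF Ex_arrowD(3)] ident_right[OF Ex_arrowD(3)])
next
  fix F G H A B D E
  assume "F \<in> Hom (Ex_cat C) A B" "G \<in> Hom (Ex_cat C) B D" "H \<in> Hom (Ex_cat C) D E"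
  then obtain f g h where "F = (A, f, B)" "G = (B, g, D)" "H = (D, h, E)"
    and "f \<in> Hom C (fst A) (fst B)" "g \<in> Hom C (fst B) (fst D)" "h \<in> Hom C (fst D) (fst E)"
    unfolding in_Ex_Hom by (blast dest: Ex_arrowD(3))
  then show "(H \<cdot>\<^bsub>Ex_cat C\<^esub> G) \<cdot>\<^bsub>Ex_cat C\<^esub> F = H \<cdot>\<^bsub>Ex_cat C\<^esub> (G \<cdot>\<^bsub>Ex_cat C\<^esub> F)"
    using comp_assoc by simp
qed (auto simp: Ex_arrows_def)

lemma tracked_equiv_iff:
  assumes A: "A \<in> her_objects C" and B: "B \<in> her_objects C"
  shows "tracked_equiv C A B f g \<longleftrightarrow>
    (A, f, B) \<in> Ex_arrows C \<and> (A, g, B) \<in> Ex_arrows C \<and> related C B f g"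
proof -
  have "tracked_equiv C A B f g \<longleftrightarrow>
      (A, f, B) \<in> Ex_arrows C \<and> (A, g, B) \<in> Ex_arrows C \<and>
      (\<exists>h \<in> Hom C (fst A) (Rel B). snd B \<cdot> h = pairing C f g)"
    using A B by (cases A; cases B) (simp add: tracked_equiv_def Ex_arrows_def)
  then show ?thesis
    using related_iff_pairing[OF her_fibrant[OF B]] Ex_arrowD(3) by blast
qed

subsection \<open>Weak equivalences\<close>

text \<open>Names the homotopy inverse, so that inverses of composites can be given explicitly. The
  condition is symmetric under exchanging \<open>f\<close> and \<open>g\<close> together with their
  endpoints.\<close>

definition inverse_up_to_homotopy where
  "inverse_up_to_homotopy A f B g \<longleftrightarrow>
     (A, f, B) \<in> Ex_arrows C \<and> (B, g, A) \<in> Ex_arrows C \<and>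
     related C B (f \<cdot> g) (\<one> (fst B)) \<and> related C A (g \<cdot> f) (\<one> (fst A))"

lemma Ex_weq_iff:
  "(A, f, B) \<in> Ex_weak_equivalences C \<longleftrightarrow> (\<exists>g. inverse_up_to_homotopy A f B g)"
proof -
  have "tracked_equiv C B B (f \<cdot> g) (\<one> (fst B)) \<longleftrightarrow> related C B (f \<cdot> g) (\<one> (fst B))"
    "tracked_equiv C A A (g \<cdot> f) (\<one> (fst A)) \<longleftrightarrow> related C A (g \<cdot> f) (\<one> (fst A))"
    if "(A, f, B) \<in> Ex_arrows C" "(B, g, A) \<in> Ex_arrows C" for g
    using tracked_equiv_iff[OF Ex_arrowD(2)[OF that(1)] Ex_arrowD(2)[OF that(1)]]
      tracked_equiv_iff[OF Ex_arrowD(1)[OF that(1)] Ex_arrowD(1)[OF that(1)]]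
      Ex_arrow_ident[OF Ex_arrowD(1)[OF that(1)]] Ex_arrow_ident[OF Ex_arrowD(2)[OF that(1)]]
      Ex_arrow_comp[OF that] Ex_arrow_comp[OF that(2,1)] by simp_all
  then show ?thesis
    unfolding Ex_weak_equivalences_def inverse_up_to_homotopy_def by auto
qed

text \<open>Whiskering gives \<open>g (f f') g' ~ g g' ~ 1\<close>. This is one half of being
  inverse; the other half is the same statement with the roles of the maps and their inverses
  exchanged.\<close>

lemma retraction_up_to_homotopy_comp:
  assumes f: "(A, f, B) \<in> Ex_arrows C" "(B, f', A) \<in> Ex_arrows C"
    and g: "(B, g, D) \<in> Ex_arrows C" "(D, g', B) \<in> Ex_arrows C"
    and rf: "related C B (f \<cdot> f') (\<one> (fst B))" and rg: "related C D (g \<cdot> g') (\<one> (fst D))"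
  shows "related C D ((g \<cdot> f) \<cdot> (f' \<cdot> g')) (\<one> (fst D))"
proof -
  note h = f[THEN Ex_arrowD(3)] g[THEN Ex_arrowD(3)]
  note obj = Ex_arrowD(1,2)[OF f(1)] Ex_arrowD(1,2)[OF g(1)]
  have 1: "f \<cdot> f' \<in> Hom C (fst B) (fst B)" using comp_hom[OF h(2,1)] .
  have 2: "(f \<cdot> f') \<cdot> g' \<in> Hom C (fst D) (fst B)" using comp_hom[OF h(4) 1] .
  have "related C B ((f \<cdot> f') \<cdot> g') g'"
    using related_precomp[OF her_fibrant rf 1 h(4)] obj ident_left[OF h(4)] by simp
  then have "related C D (g \<cdot> (f \<cdot> f') \<cdot> g') (g \<cdot> g')"
    using Ex_arrowD(4)[OF g(1) _ 2 h(4)] by blast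
  then have "related C D (g \<cdot> (f \<cdot> f') \<cdot> g') (\<one> (fst D))"
    using her_trans[OF obj(4) _ rg comp_hom[OF 2 h(3)] comp_hom[OF h(4,3)]] by blast
  then show ?thesis using h by (simp add: in_Hom arr_simps)
qed

lemma inverse_up_to_homotopy_comp:
  assumes "inverse_up_to_homotopy A f B f'" "inverse_up_to_homotopy B g D g'"
  shows "inverse_up_to_homotopy A (g \<cdot> f) D (f' \<cdot> g')"
  using assms retraction_up_to_homotopy_comp[of A f B f' g D g']
    retraction_up_to_homotopy_comp[of D g' B g f' A f] Ex_arrow_comp
  unfolding inverse_up_to_homotopy_def by blast

text \<open>With \<open>k\<close> inverse to \<open>g f\<close> and \<open>l\<close> inverse to
  \<open>h g\<close>, the arrow \<open>g\<close> has the right inverse \<open>f k\<close> and the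
  left inverse \<open>l h\<close>, which must then agree up to ~. The resulting inverses are
  \<open>k g\<close> for \<open>f\<close>, \<open>f k\<close> for \<open>g\<close> and
  \<open>g l\<close> for \<open>h\<close>.\<close>

lemma Ex_two_out_of_six:
  assumes f: "(A, f, B) \<in> Ex_arrows C" and g: "(B, g, D) \<in> Ex_arrows C"
    and h: "(D, h, E) \<in> Ex_arrows C"
    and gf: "(A, g \<cdot> f, D) \<in> Ex_weak_equivalences C"
    and hg: "(B, h \<cdot> g, E) \<in> Ex_weak_equivalences C"
  shows "(A, f, B) \<in> Ex_weak_equivalences C" "(B, g, D) \<in> Ex_weak_equivalences C"
    "(D, h, E) \<in> Ex_weak_equivalences C" "(A, h \<cdot> (g \<cdot> f), E) \<in> Ex_weak_equivalences C"
proof -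
  obtain k where k: "(D, k, A) \<in> Ex_arrows C"
    and k1: "related C D ((g \<cdot> f) \<cdot> k) (\<one> (fst D))"
    and k2: "related C A (k \<cdot> (g \<cdot> f)) (\<one> (fst A))"
    using gf unfolding Ex_weq_iff inverse_up_to_homotopy_def by blast
  obtain l where l: "(E, l, B) \<in> Ex_arrows C"
    and l1: "related C E ((h \<cdot> g) \<cdot> l) (\<one> (fst E))"
    and l2: "related C B (l \<cdot> (h \<cdot> g)) (\<one> (fst B))"
    using hg unfolding Ex_weq_iff inverse_up_to_homotopy_def by blast
  note hs = f[THEN Ex_arrowD(3)] g[THEN Ex_arrowD(3)] h[THEN Ex_arrowD(3)]
    k[THEN Ex_arrowD(3)] l[THEN Ex_arrowD(3)]
  note [simp] = hs[unfolded in_Hom] arr_simps in_Hom ident_hom[unfolded in_Hom]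
  note obj = Ex_arrowD(1,2)[OF f] Ex_arrowD(1,2)[OF h]
  have [simp]: "fst A \<in> Obj C" "fst B \<in> Obj C" "fst D \<in> Obj C" "fst E \<in> Obj C"
    using obj fibrant_relation_homs(1)[OF her_fibrant] by blast+
  note lh = Ex_arrow_comp[OF h l] and fk = Ex_arrow_comp[OF k f]
  have "related C B ((l \<cdot> h) \<cdot> (g \<cdot> f) \<cdot> k) ((l \<cdot> h) \<cdot> \<one> (fst D))"
    by (rule Ex_arrowD(4)[OF lh k1, where D = "fst D"]) simp_all
  then have 1: "related C B (l \<cdot> h \<cdot> g \<cdot> f \<cdot> k) (l \<cdot> h)" by simp
  have "related C B ((l \<cdot> h \<cdot> g) \<cdot> (f \<cdot> k)) (\<one> (fst B) \<cdot> (f \<cdot> k))"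
    by (rule related_precomp[OF her_fibrant[OF obj(2)] l2, where D = "fst B" and E = "fst D"])
      simp_all
  then have 2: "related C B (l \<cdot> h \<cdot> g \<cdot> f \<cdot> k) (f \<cdot> k)" by simp
  \<comment> \<open>Both sides are compared with \<open>l h g f k\<close>: cancelling
    \<open>g f k\<close> leaves \<open>l h\<close>, cancelling \<open>l h g\<close> leaves
    \<open>f k\<close>.\<close>
  have 3: "related C B (f \<cdot> k) (l \<cdot> h)"
    by (rule her_trans[OF obj(2) her_sym[OF obj(2) 2] 1]) simp_all
  have "related C B ((f \<cdot> k) \<cdot> g) ((l \<cdot> h) \<cdot> g)"
    by (rule related_precomp[OF her_fibrant[OF obj(2)] 3, where D = "fst D" and E = "fst B"])
      simp_all
  then have "related C B (f \<cdot> k \<cdot> g) (l \<cdot> h \<cdot> g)" by simp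
  then have 4: "related C B (f \<cdot> k \<cdot> g) (\<one> (fst B))"
    by (rule her_trans[OF obj(2) _ l2, where D = "fst B"]) simp_all
  have 5: "related C D (g \<cdot> (l \<cdot> h)) (g \<cdot> (f \<cdot> k))"
    by (rule Ex_arrowD(4)[OF g her_sym[OF obj(2) 3], where D = "fst D"]) simp_all
  have 6: "related C D (g \<cdot> l \<cdot> h) (\<one> (fst D))"
    by (rule her_trans[OF obj(3) 5, where D = "fst D"]) (use k1 in simp_all)
  have "inverse_up_to_homotopy A f B (k \<cdot> g)" "inverse_up_to_homotopy B g D (f \<cdot> k)"
    "inverse_up_to_homotopy D h E (g \<cdot> l)"
    unfolding inverse_up_to_homotopy_def
    using f g h k l Ex_arrow_comp 4 6 k1 k2 l1 by auto
  moreover from this have "inverse_up_to_homotopy A (h \<cdot> (g \<cdot> f)) E (((k \<cdot> g) \<cdot> (f \<cdot> k)) \<cdot> (g \<cdot> l))"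
    using inverse_up_to_homotopy_comp by blast
  ultimately show "(A, f, B) \<in> Ex_weak_equivalences C" "(B, g, D) \<in> Ex_weak_equivalences C"
    "(D, h, E) \<in> Ex_weak_equivalences C" "(A, h \<cdot> (g \<cdot> f), E) \<in> Ex_weak_equivalences C"
    unfolding Ex_weq_iff by blast+
qed

subsection \<open>Fibrations\<close>

text \<open>The pullback of \<open>f\<close> and \<open>src B\<close> classifies lifting problems,
  that is, an element \<open>u\<close> with a witness for \<open>f u ~ w\<close>. The map in the
  definition is the solution of the universal such problem: its source is \<open>u\<close> and its
  target is the lift. The elementwise form also removes the dependence on a particular
  pullback.\<close>

lemma Ex_fib_iff:
  "(A, f, B) \<in> Ex_fibrations C \<longleftrightarrow> (A, f, B) \<in> Ex_arrows C \<and> f \<in> Fib C \<and>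
    (\<forall>D. \<forall>u \<in> Hom C D (fst A). \<forall>w \<in> Hom C D (fst B). related C B (f \<cdot> u) w \<longrightarrow>
       (\<exists>v \<in> Hom C D (fst A). related C A u v \<and> f \<cdot> v = w))"
    (is "_ \<longleftrightarrow> _ \<and> _ \<and> ?lift")
proof -
  have unfold: "(A, f, B) \<in> Ex_fibrations C \<longleftrightarrow> (A, f, B) \<in> Ex_arrows C \<and> f \<in> Fib C \<and>
      (\<exists>p q. is_pullback C f (src B) p q \<and>
         (\<exists>n \<in> Hom C (Dom C p) (Rel A). src A \<cdot> n = p \<and> f \<cdot> tgt A \<cdot> n = tgt B \<cdot> q))"
    by (cases A; cases B) (simp add: Ex_fibrations_def)
  have "(\<exists>p q. is_pullback C f (src B) p q \<and>
      (\<exists>n \<in> Hom C (Dom C p) (Rel A). src A \<cdot> n = p \<and> f \<cdot> tgt A \<cdot> n = tgt B \<cdot> q)) \<longleftrightarrow> ?lift"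
    if f: "(A, f, B) \<in> Ex_arrows C" and fib: "f \<in> Fib C"
  proof
    note fh = Ex_arrowD(3)[OF f]
    note hA = fibrant_relation_homs[OF her_fibrant[OF Ex_arrowD(1)[OF f]]]
      and hB = fibrant_relation_homs[OF her_fibrant[OF Ex_arrowD(2)[OF f]]]
    have d: "Dom C f = fst A" "Dom C (src B) = Rel B" using fh hB by (auto simp: in_Hom)
    {
      assume "\<exists>p q. is_pullback C f (src B) p q \<and>
        (\<exists>n \<in> Hom C (Dom C p) (Rel A). src A \<cdot> n = p \<and> f \<cdot> tgt A \<cdot> n = tgt B \<cdot> q)"
      then obtain p q n where pb: "is_pullback C f (src B) p q"
        and n: "n \<in> Hom C (Dom C p) (Rel A)" "src A \<cdot> n = p" "f \<cdot> tgt A \<cdot> n = tgt B \<cdot> q"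
        by blast
      have q: "q \<in> Hom C (Dom C p) (Rel B)" using pullback_homs[OF pb] d by simp
      show ?lift
      proof (intro allI ballI impI)
        fix D u w assume u: "u \<in> Hom C D (fst A)" and w: "w \<in> Hom C D (fst B)"
          and r: "related C B (f \<cdot> u) w"
        obtain h where h: "h \<in> Hom C D (Rel B)" "src B \<cdot> h = f \<cdot> u" "tgt B \<cdot> h = w"
          using relatedE[OF r comp_hom[OF u fh]] .
        \<comment> \<open>\<open>k\<close> classifies the given lifting problem; precomposing the
          universal solution \<open>n\<close> with it solves this instance, with
          \<open>tgt A\<close> of the result as the lift.\<close>
        obtain k where k: "k \<in> Hom C D (Dom C p)" "p \<cdot> k = u" "q \<cdot> k = h"
          using pullback_lift[OF pb] u h d by metis
        note nk = comp_hom[OF k(1) n(1)]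
        have "related C A u (tgt A \<cdot> n \<cdot> k)"
          using relatedI[OF nk u] comp_assoc[OF k(1) n(1) hA(3)] n k by simp
        moreover have "f \<cdot> (tgt A \<cdot> n \<cdot> k) = (f \<cdot> tgt A \<cdot> n) \<cdot> k"
          using comp_assoc[OF k(1) n(1) hA(4)] comp_assoc[OF k(1) comp_hom[OF n(1) hA(4)] fh]
          by simp
        then have "f \<cdot> (tgt A \<cdot> n \<cdot> k) = w"
          using n comp_assoc[OF k(1) q hB(4)] h k by simp
        ultimately show "\<exists>v \<in> Hom C D (fst A). related C A u v \<and> f \<cdot> v = w"
          using comp_hom[OF nk hA(4)] by blast
      qed
    next
      assume lift: ?lift
      have "src B \<in> Arr C" "Cod C (src B) = Cod C f" using fh hB by (auto simp: in_Hom)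
      then obtain p q where pb: "is_pullback C f (src B) p q" using pullback_exists[OF fib] by blast
      have pq: "p \<in> Hom C (Dom C p) (fst A)" "q \<in> Hom C (Dom C p) (Rel B)" "f \<cdot> p = src B \<cdot> q"
        using pullback_homs[OF pb] d by simp_all
      \<comment> \<open>The universal lifting problem, with \<open>q\<close> as the witness that
        \<open>f p\<close> is related to \<open>tgt B q\<close>.\<close>
      have "related C B (f \<cdot> p) (tgt B \<cdot> q)"
        using relatedI[OF pq(2) comp_hom[OF pq(1) fh]] pq(3) by simp
      then obtain v where v: "related C A p v" "f \<cdot> v = tgt B \<cdot> q"
        using lift pq(1) comp_hom[OF pq(2) hB(4)] by blast
      then show "\<exists>p q. is_pullback C f (src B) p q \<and>
        (\<exists>n \<in> Hom C (Dom C p) (Rel A). src A \<cdot> n = p \<and> f \<cdot> tgt A \<cdot> n = tgt B \<cdot> q)"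
        using pb relatedE[OF v(1) pq(1)] by metis
    }
  qed
  then show ?thesis using unfold by blast
qed

lemma Ex_fibI:
  assumes "(A, f, B) \<in> Ex_arrows C" "f \<in> Fib C"
    and "\<And>D u w. \<lbrakk>u \<in> Hom C D (fst A); w \<in> Hom C D (fst B); related C B (f \<cdot> u) w\<rbrakk>
           \<Longrightarrow> \<exists>v \<in> Hom C D (fst A). related C A u v \<and> f \<cdot> v = w"
  shows "(A, f, B) \<in> Ex_fibrations C"
  using assms unfolding Ex_fib_iff by blast

lemma Ex_fib_lift:
  assumes "(A, f, B) \<in> Ex_fibrations C" "u \<in> Hom C D (fst A)" "w \<in> Hom C D (fst B)"
    "related C B (f \<cdot> u) w"
  obtains v where "v \<in> Hom C D (fst A)" "related C A u v" "f \<cdot> v = w"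
  using assms unfolding Ex_fib_iff by blast

lemma Ex_fib_comp:
  assumes f: "(A, f, B) \<in> Ex_fibrations C" and g: "(B, g, D) \<in> Ex_fibrations C"
  shows "(A, g \<cdot> f, D) \<in> Ex_fibrations C"
proof -
  have fa: "(A, f, B) \<in> Ex_arrows C" "f \<in> Fib C" and ga: "(B, g, D) \<in> Ex_arrows C" "g \<in> Fib C"
    using f g unfolding Ex_fib_iff by auto
  note fh = Ex_arrowD(3)[OF fa(1)] and gh = Ex_arrowD(3)[OF ga(1)]
  show ?thesis
  proof (rule Ex_fibI)
    show "(A, g \<cdot> f, D) \<in> Ex_arrows C" using Ex_arrow_comp[OF fa(1) ga(1)] .
    show "g \<cdot> f \<in> Fib C" using fib_comp fa ga fh gh by (simp add: in_Hom)
    fix E u w assume u: "u \<in> Hom C E (fst A)" and w: "w \<in> Hom C E (fst D)"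
      and r: "related C D ((g \<cdot> f) \<cdot> u) w"
    obtain v where v: "v \<in> Hom C E (fst B)" "related C B (f \<cdot> u) v" "g \<cdot> v = w"
      using Ex_fib_lift[OF g comp_hom[OF u fh] w] r comp_assoc[OF u fh gh] by auto
    obtain v' where v': "v' \<in> Hom C E (fst A)" "related C A u v'" "f \<cdot> v' = v"
      using Ex_fib_lift[OF f u v(1,2)] .
    then show "\<exists>v \<in> Hom C E (fst A). related C A u v \<and> (g \<cdot> f) \<cdot> v = w"
      using v comp_assoc[OF v'(1) fh gh] by auto
  qed
qed

text \<open>Exchanges a homotopy inverse for a strict section and a condition on relations. Since
  \<open>f\<close> preserves relations anyway, reflection says that the relation of \<open>A\<close>
  is the inverse image of that of \<open>B\<close>.\<close>

lemma Ex_acyclic_fib_iff: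
  "(A, f, B) \<in> Ex_fibrations C \<inter> Ex_weak_equivalences C \<longleftrightarrow>
    (A, f, B) \<in> Ex_fibrations C \<and> (\<exists>s \<in> Hom C (fst B) (fst A). f \<cdot> s = \<one> (fst B)) \<and>
    (\<forall>D. \<forall>u \<in> Hom C D (fst A). \<forall>v \<in> Hom C D (fst A).
       related C B (f \<cdot> u) (f \<cdot> v) \<longrightarrow> related C A u v)"
    (is "_ \<longleftrightarrow> _ \<and> ?section \<and> ?reflect")
proof (cases "(A, f, B) \<in> Ex_fibrations C")
  case fib: True
  then have fa: "(A, f, B) \<in> Ex_arrows C" unfolding Ex_fib_iff by blast
  note A = Ex_arrowD(1)[OF fa] and B = Ex_arrowD(2)[OF fa] and fh = Ex_arrowD(3)[OF fa]
  have objA: "fst A \<in> Obj C" and objB: "fst B \<in> Obj C"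
    using fibrant_relation_homs(1)[OF her_fibrant] A B by blast+
  have "(A, f, B) \<in> Ex_weak_equivalences C \<longleftrightarrow> ?section \<and> ?reflect"
  proof
    assume "(A, f, B) \<in> Ex_weak_equivalences C"
    then obtain g where g: "(B, g, A) \<in> Ex_arrows C"
      and fg: "related C B (f \<cdot> g) (\<one> (fst B))" and gf: "related C A (g \<cdot> f) (\<one> (fst A))"
      unfolding Ex_weq_iff inverse_up_to_homotopy_def by blast
    note gh = Ex_arrowD(3)[OF g]
    \<comment> \<open>The element \<open>g\<close> has image \<open>f g ~ 1\<close>; the fibration
      property moves it along this relation to an element lying exactly over the identity.\<close>
    have ?section using Ex_fib_lift[OF fib gh ident_hom[OF objB] fg] by blast
    moreover have ?reflect
    proof (intro allI ballI impI)
      fix D u v assume u: "u \<in> Hom C D (fst A)" and v: "v \<in> Hom C D (fst A)"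
        and r: "related C B (f \<cdot> u) (f \<cdot> v)"
      note fu = comp_hom[OF u fh] and fv = comp_hom[OF v fh]
      note gfu = comp_hom[OF fu gh] and gfv = comp_hom[OF fv gh]
      have 1: "related C A (g \<cdot> f \<cdot> u) (g \<cdot> f \<cdot> v)" by (rule Ex_arrowD(4)[OF g r fu fv])
      have 2: "related C A (g \<cdot> f \<cdot> w) w" if w: "w \<in> Hom C D (fst A)" for w
        using related_precomp[OF her_fibrant[OF A] gf comp_hom[OF fh gh] w]
          comp_assoc[OF w fh gh] ident_left[OF w] by simp
      \<comment> \<open>The chain \<open>u ~ g f u ~ g f v ~ v\<close>.\<close>
      show "related C A u v"
        using her_trans[OF A her_sym[OF A 2[OF u] gfu u] her_trans[OF A 1 2[OF v] gfu gfv] u gfu] .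
    qed
    ultimately show "?section \<and> ?reflect" by blast
  next
    assume "?section \<and> ?reflect"
    then obtain s where s: "s \<in> Hom C (fst B) (fst A)" "f \<cdot> s = \<one> (fst B)"
      and reflect: "\<And>D u v. \<lbrakk>u \<in> Hom C D (fst A); v \<in> Hom C D (fst A);
        related C B (f \<cdot> u) (f \<cdot> v)\<rbrakk> \<Longrightarrow> related C A u v" by blast
    have fs: "f \<cdot> s \<cdot> u = u" if u: "u \<in> Hom C D (fst B)" for D u
      using comp_assoc[OF u s(1) fh] s(2) ident_left[OF u] by simp
    \<comment> \<open>A section in \<open>C\<close> need not preserve relations; here it does, since
      \<open>f s u = u ~ v = f s v\<close> is reflected to \<open>s u ~ s v\<close>.\<close>
    have "(B, s, A) \<in> Ex_arrows C"
    proof (rule Ex_arrowI[OF B A s(1)])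
      fix D u v assume "u \<in> Hom C D (fst B)" "v \<in> Hom C D (fst B)" "related C B u v"
      then show "related C A (s \<cdot> u) (s \<cdot> v)"
        using reflect[OF comp_hom[OF _ s(1)] comp_hom[OF _ s(1)]] fs by simp
    qed
    moreover have "related C B (f \<cdot> s) (\<one> (fst B))"
      using s(2) her_refl[OF B ident_hom[OF objB]] by simp
    \<comment> \<open>Reflected from the strict equation \<open>f s f = f\<close>.\<close>
    moreover have "related C A (s \<cdot> f) (\<one> (fst A))"
      using reflect[OF comp_hom[OF fh s(1)] ident_hom[OF objA]] fs[OF fh]
        ident_right[OF fh] her_refl[OF B fh] by simp
    ultimately show "(A, f, B) \<in> Ex_weak_equivalences C"
      unfolding Ex_weq_iff inverse_up_to_homotopy_def using fa by blast
  qed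
  with fib show ?thesis by blast
qed auto

text \<open>The inverse in Ex also preserves relations, which is more than invertibility in
  \<open>C\<close>: it lifts \<open>w\<close> to \<open>g w\<close>, and applying it to related
  images reflects the relation.\<close>

lemma Ex_iso_acyclic_fib:
  assumes "is_iso (Ex_cat C) F"
  shows "F \<in> Ex_fibrations C \<inter> Ex_weak_equivalences C"
proof -
  obtain A f B g where F: "F = (A, f, B)" and f: "(A, f, B) \<in> Ex_arrows C"
    and g: "(B, g, A) \<in> Ex_arrows C" and gf: "g \<cdot> f = \<one> (fst A)" and fg: "f \<cdot> g = \<one> (fst B)"
    using assms unfolding is_iso_def by (cases F) (auto simp: in_Ex_Hom)
  note fh = Ex_arrowD(3)[OF f] and gh = Ex_arrowD(3)[OF g]
  have gfu: "g \<cdot> f \<cdot> u = u" if u: "u \<in> Hom C D (fst A)" for D u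
    using comp_assoc[OF u fh gh] ident_left[OF u] gf by simp
  have fgu: "f \<cdot> g \<cdot> u = u" if u: "u \<in> Hom C D (fst B)" for D u
    using comp_assoc[OF u gh fh] ident_left[OF u] fg by simp
  have "(A, f, B) \<in> Ex_fibrations C"
  proof (rule Ex_fibI[OF f])
    show "f \<in> Fib C" using iso_acyclic_fib isoI[OF fh gh gf fg] by blast
    fix D u w assume u: "u \<in> Hom C D (fst A)" and w: "w \<in> Hom C D (fst B)"
      and r: "related C B (f \<cdot> u) w"
    have "related C A u (g \<cdot> w)"
      using Ex_arrowD(4)[OF g r comp_hom[OF u fh] w] gfu[OF u] by simp
    then show "\<exists>v \<in> Hom C D (fst A). related C A u v \<and> f \<cdot> v = w"
      using fgu[OF w] comp_hom[OF w gh] by blast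
  qed
  moreover have "related C A u v"
    if "u \<in> Hom C D (fst A)" "v \<in> Hom C D (fst A)" "related C B (f \<cdot> u) (f \<cdot> v)" for D u v
    using Ex_arrowD(4)[OF g that(3) comp_hom[OF that(1) fh] comp_hom[OF that(2) fh]] gfu that by simp
  ultimately show ?thesis
    unfolding F Ex_acyclic_fib_iff using gh fg by blast
qed

end

subsection \<open>Pullbacks and path objects in Ex\<close>

context path_category
begin

text \<open>The pullback of \<open>C\<close> with the coarsest relation for which both projections
  preserve relations, so that an arrow into it preserves relations iff its two components
  do.\<close>

lemma Ex_pullback:
  assumes fib: "(A, f, B) \<in> Ex_fibrations C" and g: "(D, g, B) \<in> Ex_arrows C"
  obtains P p q where
    "is_pullback (Ex_cat C) (A, f, B) (D, g, B) (P, p, A) (P, q, D)"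
    "(P, q, D) \<in> Ex_fibrations C"
    "(A, f, B) \<in> Ex_weak_equivalences C \<Longrightarrow> (P, q, D) \<in> Ex_weak_equivalences C"
proof -
  have f: "(A, f, B) \<in> Ex_arrows C" and f_fib: "f \<in> Fib C" using fib unfolding Ex_fib_iff by auto
  note A = Ex_arrowD(1)[OF f] and B = Ex_arrowD(2)[OF f] and D = Ex_arrowD(1)[OF g]
  note fh = Ex_arrowD(3)[OF f] and gh = Ex_arrowD(3)[OF g]
  have d: "Dom C f = fst A" "Dom C g = fst D" using fh gh by (auto simp: in_Hom)
  have "g \<in> Arr C" "Cod C g = Cod C f" using fh gh by (auto simp: in_Hom)
  then obtain p q where pb: "is_pullback C f g p q" using pullback_exists[OF f_fib] by blast
  let ?Z = "Dom C p"
  have p: "p \<in> Hom C ?Z (fst A)" and q: "q \<in> Hom C ?Z (fst D)" and fp: "f \<cdot> p = g \<cdot> q"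
    using pullback_homs[OF pb] d by simp_all
  obtain r where P: "(?Z, r) \<in> her_objects C"
    and rel: "\<And>E u v. \<lbrakk>u \<in> Hom C E ?Z; v \<in> Hom C E ?Z\<rbrakk> \<Longrightarrow> related C (?Z, r) u v \<longleftrightarrow>
                related C A (p \<cdot> u) (p \<cdot> v) \<and> related C D (q \<cdot> u) (q \<cdot> v)"
    using joint_inverse_image_her[OF A D p q] by blast
  let ?P = "(?Z, r)"
  have fpu: "f \<cdot> p \<cdot> u = g \<cdot> q \<cdot> u" if u: "u \<in> Hom C E ?Z" for E u
    using comp_assoc[OF u p fh] comp_assoc[OF u q gh] fp by simp
  have pa: "(?P, p, A) \<in> Ex_arrows C" by (rule Ex_arrowI[OF P A]) (use p rel in auto)
  have qa: "(?P, q, D) \<in> Ex_arrows C" by (rule Ex_arrowI[OF P D]) (use q rel in auto)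
  interpret E: category "Ex_cat C" by (rule Ex_category)
  have 1: "is_pullback (Ex_cat C) (A, f, B) (D, g, B) (?P, p, A) (?P, q, D)"
  proof (rule E.pullbackI)
    show "(A, f, B) \<in> Hom (Ex_cat C) A B" "(D, g, B) \<in> Hom (Ex_cat C) D B"
      "(?P, p, A) \<in> Hom (Ex_cat C) ?P A" "(?P, q, D) \<in> Hom (Ex_cat C) ?P D"
      using f g pa qa by (auto simp: in_Ex_Hom)
    show "(A, f, B) \<cdot>\<^bsub>Ex_cat C\<^esub> (?P, p, A) = (D, g, B) \<cdot>\<^bsub>Ex_cat C\<^esub> (?P, q, D)"
      using fp by simp
  next
    fix Y U V assume "U \<in> Hom (Ex_cat C) Y A" "V \<in> Hom (Ex_cat C) Y D"
      and eq: "(A, f, B) \<cdot>\<^bsub>Ex_cat C\<^esub> U = (D, g, B) \<cdot>\<^bsub>Ex_cat C\<^esub> V"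
    then obtain u v where uv: "U = (Y, u, A)" "V = (Y, v, D)"
      and u: "(Y, u, A) \<in> Ex_arrows C" and v: "(Y, v, D) \<in> Ex_arrows C"
      unfolding in_Ex_Hom by blast
    note uh = Ex_arrowD(3)[OF u] and vh = Ex_arrowD(3)[OF v]
    obtain w where w: "w \<in> Hom C (fst Y) ?Z" "p \<cdot> w = u" "q \<cdot> w = v"
      using pullback_lift[OF pb, of u "fst Y" v] uh vh d eq uv by auto
    have "(Y, w, ?P) \<in> Ex_arrows C"
    proof (rule Ex_arrowI[OF Ex_arrowD(1)[OF u] P])
      show "w \<in> Hom C (fst Y) (fst ?P)" using w by simp
      fix X a b assume a: "a \<in> Hom C X (fst Y)" and b: "b \<in> Hom C X (fst Y)" and r: "related C Y a b"
      have pq: "p \<cdot> w \<cdot> c = u \<cdot> c" "q \<cdot> w \<cdot> c = v \<cdot> c" if c: "c \<in> Hom C X (fst Y)" for c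
        using comp_assoc[OF c w(1) p] comp_assoc[OF c w(1) q] w by simp_all
      show "related C ?P (w \<cdot> a) (w \<cdot> b)"
        using rel[OF comp_hom[OF a w(1)] comp_hom[OF b w(1)]] pq[OF a] pq[OF b]
          Ex_arrowD(4)[OF u r a b] Ex_arrowD(4)[OF v r a b] by simp
    qed
    then show "\<exists>W \<in> Hom (Ex_cat C) Y ?P.
        (?P, p, A) \<cdot>\<^bsub>Ex_cat C\<^esub> W = U \<and> (?P, q, D) \<cdot>\<^bsub>Ex_cat C\<^esub> W = V"
      using w uv by (intro bexI[of _ "(Y, w, ?P)"]) (auto simp: in_Ex_Hom)
  next
    fix Y W W' assume "W \<in> Hom (Ex_cat C) Y ?P" "W' \<in> Hom (Ex_cat C) Y ?P"
      and eq: "(?P, p, A) \<cdot>\<^bsub>Ex_cat C\<^esub> W = (?P, p, A) \<cdot>\<^bsub>Ex_cat C\<^esub> W'"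
        "(?P, q, D) \<cdot>\<^bsub>Ex_cat C\<^esub> W = (?P, q, D) \<cdot>\<^bsub>Ex_cat C\<^esub> W'"
    then obtain w w' where W: "W = (Y, w, ?P)" "W' = (Y, w', ?P)"
      and w: "(Y, w, ?P) \<in> Ex_arrows C" "(Y, w', ?P) \<in> Ex_arrows C"
      unfolding in_Ex_Hom by blast
    have "w = w'"
      using pullback_ext[OF pb] Ex_arrowD(3)[OF w(1)] Ex_arrowD(3)[OF w(2)] eq W by simp
    with W show "W = W'" by simp
  qed
  have 2: "(?P, q, D) \<in> Ex_fibrations C"
  proof (rule Ex_fibI[OF qa pullback_fib[OF f_fib pb]])
    fix E u w assume "u \<in> Hom C E (fst ?P)" and w: "w \<in> Hom C E (fst D)"
      and r: "related C D (q \<cdot> u) w"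
    then have u: "u \<in> Hom C E ?Z" by simp
    note pu = comp_hom[OF u p] and qu = comp_hom[OF u q]
    \<comment> \<open>From \<open>q u ~ w\<close> follows \<open>f p u = g q u ~ g w\<close>. The
      lift \<open>x\<close> along \<open>f\<close> lies strictly over \<open>g w\<close>, so
      \<open>x\<close> and \<open>w\<close> define an element of the pullback.\<close>
    have "related C B (f \<cdot> p \<cdot> u) (g \<cdot> w)"
      using Ex_arrowD(4)[OF g r qu w] fpu[OF u] by simp
    then obtain x where x: "x \<in> Hom C E (fst A)" "related C A (p \<cdot> u) x" "f \<cdot> x = g \<cdot> w"
      using Ex_fib_lift[OF fib pu comp_hom[OF w gh]] by blast
    obtain v where v: "v \<in> Hom C E ?Z" "p \<cdot> v = x" "q \<cdot> v = w"
      using pullback_lift[OF pb, of x E w] x w d by auto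
    then show "\<exists>v \<in> Hom C E (fst ?P). related C ?P u v \<and> q \<cdot> v = w"
      using rel[OF u v(1)] x r by auto
  qed
  have 3: "(?P, q, D) \<in> Ex_weak_equivalences C" if weq: "(A, f, B) \<in> Ex_weak_equivalences C"
  proof -
    obtain s where s: "s \<in> Hom C (fst B) (fst A)" "f \<cdot> s = \<one> (fst B)"
      and reflect: "\<And>E u v. \<lbrakk>u \<in> Hom C E (fst A); v \<in> Hom C E (fst A);
        related C B (f \<cdot> u) (f \<cdot> v)\<rbrakk> \<Longrightarrow> related C A u v"
      using weq fib Ex_acyclic_fib_iff[of A f B] by blast
    have objD: "fst D \<in> Obj C" using Hom_dom_obj[OF gh] .
    \<comment> \<open>The pair of \<open>s g\<close> and the identity is the section of
      \<open>q\<close> induced by the section \<open>s\<close> of \<open>f\<close>.\<close>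
    have "f \<cdot> (s \<cdot> g) = g \<cdot> \<one> (fst D)"
      using comp_assoc[OF gh s(1) fh] s(2) ident_left[OF gh] ident_right[OF gh] by simp
    then obtain t where "t \<in> Hom C (fst D) ?Z" "q \<cdot> t = \<one> (fst D)"
      using pullback_lift[OF pb, of "s \<cdot> g" "fst D" "\<one> (fst D)"]
        comp_hom[OF gh s(1)] ident_hom[OF objD] d by auto
    moreover have "related C ?P u v"
      if u: "u \<in> Hom C E ?Z" and v: "v \<in> Hom C E ?Z" and r: "related C D (q \<cdot> u) (q \<cdot> v)" for E u v
    proof -
      have "related C B (f \<cdot> p \<cdot> u) (f \<cdot> p \<cdot> v)"
        using Ex_arrowD(4)[OF g r comp_hom[OF u q] comp_hom[OF v q]] fpu[OF u] fpu[OF v] by simp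
      then show ?thesis using reflect[OF comp_hom[OF u p] comp_hom[OF v p]] rel[OF u v] r by blast
    qed
    ultimately show ?thesis using 2 Ex_acyclic_fib_iff[of ?P q D] by (simp, blast)
  qed
  show thesis using that[OF 1 2 3] .
qed

text \<open>The chosen product of Ex is arbitrary, so a product with known underlying object and
  known relation is needed for computations. Keeping the projections of \<open>C\<close> makes
  \<open>snd A\<close> itself an arrow into this product.\<close>

lemma Ex_product:
  assumes A: "A \<in> her_objects C" and B: "B \<in> her_objects C"
  obtains P where "fst P = prod_obj C (fst A) (fst B)"
    "is_product (Ex_cat C) A B
       (P, (P, proj1 C (fst A) (fst B), A), (P, proj2 C (fst A) (fst B), B))"
    "\<And>D u v. \<lbrakk>u \<in> Hom C D (fst P); v \<in> Hom C D (fst P)\<rbrakk> \<Longrightarrow> related C P u v \<longleftrightarrow>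
       related C A (proj1 C (fst A) (fst B) \<cdot> u) (proj1 C (fst A) (fst B) \<cdot> v) \<and>
       related C B (proj2 C (fst A) (fst B) \<cdot> u) (proj2 C (fst A) (fst B) \<cdot> v)"
proof -
  let ?Z = "prod_obj C (fst A) (fst B)"
  let ?p = "proj1 C (fst A) (fst B)" and ?q = "proj2 C (fst A) (fst B)"
  have obj: "fst A \<in> Obj C" "fst B \<in> Obj C"
    using fibrant_relation_homs(1)[OF her_fibrant] A B by blast+
  note p = proj1_hom[OF obj] and q = proj2_hom[OF obj] and pr = chosen_product[OF obj]
  obtain r where P: "(?Z, r) \<in> her_objects C"
    and rel: "\<And>E u v. \<lbrakk>u \<in> Hom C E ?Z; v \<in> Hom C E ?Z\<rbrakk> \<Longrightarrow> related C (?Z, r) u v \<longleftrightarrow>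
                related C A (?p \<cdot> u) (?p \<cdot> v) \<and> related C B (?q \<cdot> u) (?q \<cdot> v)"
    using joint_inverse_image_her[OF A B p q] by blast
  let ?P = "(?Z, r)"
  have pa: "(?P, ?p, A) \<in> Ex_arrows C" by (rule Ex_arrowI[OF P A]) (use p rel in auto)
  have qa: "(?P, ?q, B) \<in> Ex_arrows C" by (rule Ex_arrowI[OF P B]) (use q rel in auto)
  interpret E: category "Ex_cat C" by (rule Ex_category)
  have 1: "is_product (Ex_cat C) A B (?P, (?P, ?p, A), (?P, ?q, B))"
  proof (rule E.productI)
    show "(?P, ?p, A) \<in> Hom (Ex_cat C) ?P A" "(?P, ?q, B) \<in> Hom (Ex_cat C) ?P B"
      using pa qa by (auto simp: in_Ex_Hom)
  next
    fix Y U V assume "U \<in> Hom (Ex_cat C) Y A" "V \<in> Hom (Ex_cat C) Y B"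
    then obtain u v where uv: "U = (Y, u, A)" "V = (Y, v, B)"
      and u: "(Y, u, A) \<in> Ex_arrows C" and v: "(Y, v, B) \<in> Ex_arrows C"
      unfolding in_Ex_Hom by blast
    note uh = Ex_arrowD(3)[OF u] and vh = Ex_arrowD(3)[OF v]
    obtain w where w: "w \<in> Hom C (fst Y) ?Z" "?p \<cdot> w = u" "?q \<cdot> w = v"
      using product_lift[OF pr uh vh] by blast
    have "(Y, w, ?P) \<in> Ex_arrows C"
    proof (rule Ex_arrowI[OF Ex_arrowD(1)[OF u] P])
      show "w \<in> Hom C (fst Y) (fst ?P)" using w by simp
      fix X a b assume a: "a \<in> Hom C X (fst Y)" and b: "b \<in> Hom C X (fst Y)" and r: "related C Y a b"
      have pq: "?p \<cdot> w \<cdot> c = u \<cdot> c" "?q \<cdot> w \<cdot> c = v \<cdot> c" if c: "c \<in> Hom C X (fst Y)" for c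
        using comp_assoc[OF c w(1) p] comp_assoc[OF c w(1) q] w by simp_all
      show "related C ?P (w \<cdot> a) (w \<cdot> b)"
        using rel[OF comp_hom[OF a w(1)] comp_hom[OF b w(1)]] pq[OF a] pq[OF b]
          Ex_arrowD(4)[OF u r a b] Ex_arrowD(4)[OF v r a b] by simp
    qed
    then show "\<exists>W \<in> Hom (Ex_cat C) Y ?P.
        (?P, ?p, A) \<cdot>\<^bsub>Ex_cat C\<^esub> W = U \<and> (?P, ?q, B) \<cdot>\<^bsub>Ex_cat C\<^esub> W = V"
      using w uv by (intro bexI[of _ "(Y, w, ?P)"]) (auto simp: in_Ex_Hom)
  next
    fix Y W W' assume "W \<in> Hom (Ex_cat C) Y ?P" "W' \<in> Hom (Ex_cat C) Y ?P"
      and eq: "(?P, ?p, A) \<cdot>\<^bsub>Ex_cat C\<^esub> W = (?P, ?p, A) \<cdot>\<^bsub>Ex_cat C\<^esub> W'"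
        "(?P, ?q, B) \<cdot>\<^bsub>Ex_cat C\<^esub> W = (?P, ?q, B) \<cdot>\<^bsub>Ex_cat C\<^esub> W'"
    then obtain w w' where W: "W = (Y, w, ?P)" "W' = (Y, w', ?P)"
      and w: "(Y, w, ?P) \<in> Ex_arrows C" "(Y, w', ?P) \<in> Ex_arrows C"
      unfolding in_Ex_Hom by blast
    have "w = w'"
      using product_ext[OF pr] Ex_arrowD(3)[OF w(1)] Ex_arrowD(3)[OF w(2)] eq W by simp
    with W show "W = W'" by simp
  qed
  show thesis using that[of ?P, OF _ 1] rel by simp
qed

lemma Ex_category_with_products: "category_with_products (Ex_cat C)"
proof (intro category_with_products.intro Ex_category category_with_products_axioms.intro)
  fix A B assume "A \<in> Obj (Ex_cat C)" "B \<in> Obj (Ex_cat C)"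
  then have A: "A \<in> her_objects C" and B: "B \<in> her_objects C" by simp_all
  show "\<exists>c. is_product (Ex_cat C) A B c"
    by (rule Ex_product[OF A B]) (rule exI, assumption)
qed

text \<open>The path object of \<open>A = (X, R)\<close> is \<open>R\<close> itself; two elements of \<open>R\<close> are related if their
  sources are, since then their targets are as well.\<close>

lemma Ex_path_object:
  assumes A: "A \<in> her_objects C"
  obtains P r p where "path_object (Ex_cat C) A r p" "Dom (Ex_cat C) p = P" "P \<in> her_objects C"
    "fst P = Rel A"
    "comp1 (Ex_cat C) A p = (P, src A, A)" "comp2 (Ex_cat C) A p = (P, tgt A, A)"
    "\<forall>D. \<forall>u \<in> Hom C D (fst P). \<forall>v \<in> Hom C D (fst P).
       related C P u v \<longleftrightarrow> related C A (src A \<cdot> u) (src A \<cdot> v)"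
proof -
  interpret E: category_with_products "Ex_cat C" by (rule Ex_category_with_products)
  let ?\<pi>1 = "proj1 C (fst A) (fst A)" and ?\<pi>2 = "proj2 C (fst A) (fst A)"
  note hA = fibrant_relation_homs[OF her_fibrant[OF A]]
  have AE: "A \<in> Obj (Ex_cat C)" using A by simp
  \<comment> \<open>Both legs of the joint inverse image are taken to be \<open>src A\<close>, which
    collapses the conjunction to a single inverse image.\<close>
  obtain r where P: "(Rel A, r) \<in> her_objects C"
    and rel: "\<And>D u v. \<lbrakk>u \<in> Hom C D (Rel A); v \<in> Hom C D (Rel A)\<rbrakk>
       \<Longrightarrow> related C (Rel A, r) u v \<longleftrightarrow> related C A (src A \<cdot> u) (src A \<cdot> v)"
    by (rule joint_inverse_image_her[OF A A hA(3) hA(3)]) (rule that, assumption, simp)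
  define P where "P = (Rel A, r)"
  have P: "P \<in> her_objects C" and fstP: "fst P = Rel A" using P unfolding P_def by auto
  have rel: "related C P u v \<longleftrightarrow> related C A (src A \<cdot> u) (src A \<cdot> v)"
    if "u \<in> Hom C D (Rel A)" "v \<in> Hom C D (Rel A)" for D u v
    using rel that unfolding P_def by blast
  have st: "related C A (src A \<cdot> u) (tgt A \<cdot> u)" if u: "u \<in> Hom C D (Rel A)" for D u
    using relatedI[OF u comp_hom[OF u hA(3)]] by blast
  have tgt: "related C A (tgt A \<cdot> u) (tgt A \<cdot> v)"
    if u: "u \<in> Hom C D (Rel A)" and v: "v \<in> Hom C D (Rel A)"
      and r: "related C A (src A \<cdot> u) (src A \<cdot> v)" for D u v
  proof -
    note su = comp_hom[OF u hA(3)] and sv = comp_hom[OF v hA(3)] and tu = comp_hom[OF u hA(4)]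
    show ?thesis
      using her_trans[OF A her_sym[OF A st[OF u] su tu] her_trans[OF A r st[OF v] su sv] tu su] .
  qed
  obtain Q where fstQ: "fst Q = prod_obj C (fst A) (fst A)"
    and pr: "is_product (Ex_cat C) A A (Q, (Q, ?\<pi>1, A), (Q, ?\<pi>2, A))"
    and relQ: "\<And>D u v. \<lbrakk>u \<in> Hom C D (fst Q); v \<in> Hom C D (fst Q)\<rbrakk> \<Longrightarrow> related C Q u v \<longleftrightarrow>
       related C A (?\<pi>1 \<cdot> u) (?\<pi>1 \<cdot> v) \<and> related C A (?\<pi>2 \<cdot> u) (?\<pi>2 \<cdot> v)"
    using Ex_product[OF A A] by blast
  have Q: "Q \<in> her_objects C"
    using E.product_homs(1)[OF pr] by (auto simp: in_Ex_Hom dest: Ex_arrowD)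
  have \<pi>: "?\<pi>1 \<cdot> snd A \<cdot> u = src A \<cdot> u" "?\<pi>2 \<cdot> snd A \<cdot> u = tgt A \<cdot> u"
    if u: "u \<in> Hom C D (Rel A)" for D u
    unfolding comp1_def comp2_def
    using comp_assoc[OF u hA(2) proj1_hom] comp_assoc[OF u hA(2) proj2_hom] hA(1) by simp_all
  have p_arr: "(P, snd A, Q) \<in> Ex_arrows C"
  proof (rule Ex_arrowI[OF P Q])
    show "snd A \<in> Hom C (fst P) (fst Q)" using hA(2) fstP fstQ by simp
    fix D u v assume "u \<in> Hom C D (fst P)" "v \<in> Hom C D (fst P)" and r: "related C P u v"
    then have u: "u \<in> Hom C D (Rel A)" and v: "v \<in> Hom C D (Rel A)" using fstP by simp_all
    show "related C Q (snd A \<cdot> u) (snd A \<cdot> v)"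
      using relQ comp_hom[OF u hA(2)] comp_hom[OF v hA(2)] \<pi>[OF u] \<pi>[OF v] fstQ
        r rel[OF u v] tgt[OF u v] by simp
  qed
  have p_fib: "(P, snd A, Q) \<in> Ex_fibrations C"
  proof (rule Ex_fibI[OF p_arr fibrant_relation_fibs(1)[OF her_fibrant[OF A]]])
    fix D u w assume "u \<in> Hom C D (fst P)" and w: "w \<in> Hom C D (fst Q)"
      and r: "related C Q (snd A \<cdot> u) w"
    then have u: "u \<in> Hom C D (Rel A)" and w': "w \<in> Hom C D (prod_obj C (fst A) (fst A))"
      using fstP fstQ by simp_all
    have r1: "related C A (src A \<cdot> u) (?\<pi>1 \<cdot> w)" and r2: "related C A (tgt A \<cdot> u) (?\<pi>2 \<cdot> w)"
      using relQ[OF _ w] r \<pi>[OF u] comp_hom[OF u hA(2)] fstQ by simp_all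
    note su = comp_hom[OF u hA(3)] and tu = comp_hom[OF u hA(4)]
      and w1 = comp_hom[OF w' proj1_hom[OF hA(1) hA(1)]]
      and w2 = comp_hom[OF w' proj2_hom[OF hA(1) hA(1)]]
    \<comment> \<open>The chain from the first component of \<open>w\<close> through
      \<open>src u ~ tgt u\<close> to its second component puts \<open>w\<close> itself into
      \<open>R\<close>. The resulting \<open>v\<close> lies strictly over \<open>w\<close>, and is
      related to \<open>u\<close> because their sources are related.\<close>
    have "related C A (?\<pi>1 \<cdot> w) (?\<pi>2 \<cdot> w)"
      using her_trans[OF A her_sym[OF A r1 su w1] her_trans[OF A st[OF u] r2 su tu] w1 su] .
    then obtain v where v: "v \<in> Hom C D (Rel A)" "src A \<cdot> v = ?\<pi>1 \<cdot> w" "tgt A \<cdot> v = ?\<pi>2 \<cdot> w"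
      using relatedE[OF _ w1] by metis
    have "snd A \<cdot> v = w"
      using prod_eqI[OF comp_hom[OF v(1) hA(2)] w' hA(1) hA(1)] \<pi>[OF v(1)] v by simp
    moreover have "related C P u v" using rel[OF u v(1)] r1 v by simp
    ultimately show "\<exists>v \<in> Hom C D (fst P). related C P u v \<and> snd A \<cdot> v = w"
      using v(1) fstP by auto
  qed
  have idA: "\<one> (fst A) \<in> Hom C (fst A) (fst A)" using ident_hom[OF hA(1)] .
  obtain i where i: "i \<in> Hom C (fst A) (Rel A)" "src A \<cdot> i = \<one> (fst A)" "tgt A \<cdot> i = \<one> (fst A)"
    using relatedE[OF her_refl[OF A idA] idA] .
  have si: "src A \<cdot> i \<cdot> u = u" if u: "u \<in> Hom C D (fst A)" for D u
    using comp_assoc[OF u i(1) hA(3)] i ident_left[OF u] by simp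
  have i_arr: "(A, i, P) \<in> Ex_arrows C"
  proof (rule Ex_arrowI[OF A P])
    show "i \<in> Hom C (fst A) (fst P)" using i(1) fstP by simp
    fix D u v assume u: "u \<in> Hom C D (fst A)" and v: "v \<in> Hom C D (fst A)" and r: "related C A u v"
    then show "related C P (i \<cdot> u) (i \<cdot> v)"
      using rel[OF comp_hom[OF u i(1)] comp_hom[OF v i(1)]] si by simp
  qed
  have src_arr: "(P, src A, A) \<in> Ex_arrows C"
    by (rule Ex_arrowI[OF P A]) (use hA(3) fstP rel in auto)
  have idP: "\<one> (Rel A) \<in> Hom C (Rel A) (Rel A)" using ident_hom[OF hA(5)] .
  \<comment> \<open>The relation on \<open>P\<close> sees only sources, and
    \<open>src i src = src\<close>; this makes the reflexivity map \<open>i\<close> a weak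
    equivalence with inverse \<open>src A\<close>.\<close>
  have "related C P (i \<cdot> src A) (\<one> (Rel A))"
    using rel[OF comp_hom[OF hA(3) i(1)] idP] si[OF hA(3)] ident_right[OF hA(3)]
      her_refl[OF A hA(3)] by simp
  then have "inverse_up_to_homotopy A i P (src A)"
    unfolding inverse_up_to_homotopy_def
    using i_arr src_arr her_refl[OF A idA] i(2) fstP by simp
  then have i_weq: "(A, i, P) \<in> Ex_weak_equivalences C" unfolding Ex_weq_iff by blast
  \<comment> \<open>\<open>e\<close> changes the codomain from the explicit product \<open>Q\<close>
    to the chosen product of Ex, in terms of which path objects are defined. It is compatible with
    the projections, so the components stay the same, and it is itself a fibration.\<close>
  obtain e where e: "is_iso (Ex_cat C) e" "e \<in> Hom (Ex_cat C) Q (prod_obj (Ex_cat C) A A)"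
    and e1: "proj1 (Ex_cat C) A A \<cdot>\<^bsub>Ex_cat C\<^esub> e = (Q, ?\<pi>1, A)"
    and e2: "proj2 (Ex_cat C) A A \<cdot>\<^bsub>Ex_cat C\<^esub> e = (Q, ?\<pi>2, A)"
    using E.product_unique[OF E.chosen_product[OF AE AE] pr] by blast
  have pE: "(P, snd A, Q) \<in> Hom (Ex_cat C) P Q" and iE: "(A, i, P) \<in> Hom (Ex_cat C) A P"
    using p_arr i_arr by (auto simp: in_Ex_Hom)
  obtain e' where e': "e = (Q, e', prod_obj (Ex_cat C) A A)" using e(2) unfolding in_Ex_Hom by blast
  let ?p = "e \<cdot>\<^bsub>Ex_cat C\<^esub> (P, snd A, Q)"
  note pH = E.comp_hom[OF pE e(2)]
  have dom: "Dom (Ex_cat C) ?p = P" using e' by simp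
  have c1: "comp1 (Ex_cat C) A ?p = (P, src A, A)"
    unfolding comp1_def[of "Ex_cat C"]
    using E.comp_assoc[OF pE e(2) E.proj1_hom[OF AE AE]] e1 by (simp add: comp1_def)
  have c2: "comp2 (Ex_cat C) A ?p = (P, tgt A, A)"
    unfolding comp2_def[of "Ex_cat C"]
    using E.comp_assoc[OF pE e(2) E.proj2_hom[OF AE AE]] e2 by (simp add: comp2_def)
  have "?p \<cdot>\<^bsub>Ex_cat C\<^esub> (A, i, P) = diag (Ex_cat C) A"
    by (rule E.comp_eqI[OF AE E.comp_hom[OF iE pH] E.diag(1)[OF AE]])
      (use E.comp1_comp[OF AE pH iE] E.comp2_comp[OF AE pH iE] E.comp_diag[OF AE] c1 c2 i in simp_all)
  moreover have "?p \<in> Ex_fibrations C"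
    using Ex_fib_comp[OF p_fib] Ex_iso_acyclic_fib[OF e(1)] e' by simp
  ultimately have "path_object (Ex_cat C) A (A, i, P) ?p"
    unfolding path_object_def dom using iE pH i_weq by simp
  then show thesis using that[OF _ dom P fstP c1 c2] rel fstP by simp
qed

section \<open>The path category axioms for Ex\<close>

theorem Ex_path_category: "path_category (Ex_cat C)"
proof -
  interpret E: category_with_products "Ex_cat C" by (rule Ex_category_with_products)
  \<comment> \<open>The axioms concern an arbitrary pullback square, whose vertex carries an unknown
    relation. Its projection \<open>Q\<close> is the projection of the constructed pullback
    precomposed with the comparison isomorphism, an acyclic fibration.\<close>
  have pb: "Q \<in> Ex_fibrations C \<and> (F \<in> Ex_weak_equivalences C \<longrightarrow> Q \<in> Ex_weak_equivalences C)"
    if F: "F \<in> Ex_fibrations C" and pb: "is_pullback (Ex_cat C) F G P Q" for F G P Q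
  proof -
    obtain A f B where f: "F = (A, f, B)" by (cases F) auto
    obtain D g where g: "G = (D, g, B)" "(D, g, B) \<in> Ex_arrows C"
      using E.pullback_homs(2)[OF pb] unfolding f Ex_cat_simps in_Ex_Hom by blast
    obtain Z p q where pb': "is_pullback (Ex_cat C) (A, f, B) (D, g, B) (Z, p, A) (Z, q, D)"
      and q: "(Z, q, D) \<in> Ex_fibrations C"
        "(A, f, B) \<in> Ex_weak_equivalences C \<Longrightarrow> (Z, q, D) \<in> Ex_weak_equivalences C"
      using Ex_pullback[OF F[unfolded f] g(2)] by blast
    obtain e where e: "is_iso (Ex_cat C) e" "e \<in> Hom (Ex_cat C) (Dom (Ex_cat C) P) Z"
      "(Z, q, D) \<cdot>\<^bsub>Ex_cat C\<^esub> e = Q"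
      by (rule E.pullback_unique[OF pb' pb[unfolded f g]]) (rule that, assumption, simp, assumption)
    obtain Y e' where e': "e = (Y, e', Z)" using e(2) unfolding in_Ex_Hom by blast
    have Q: "Q = (Y, q \<cdot> e', D)" using e(3) e' by simp
    have "(Y, e', Z) \<in> Ex_fibrations C" "(Y, e', Z) \<in> Ex_weak_equivalences C"
      using Ex_iso_acyclic_fib[OF e(1)] e' by auto
    then show ?thesis
      unfolding Q f Ex_weq_iff
      using Ex_fib_comp[OF _ q(1)] q(2) inverse_up_to_homotopy_comp unfolding Ex_weq_iff by blast
  qed
  show ?thesis
  proof
    show "Fib (Ex_cat C) \<subseteq> Arr (Ex_cat C)" "Weq (Ex_cat C) \<subseteq> Arr (Ex_cat C)"
      by (auto simp: Ex_fibrations_def Ex_weak_equivalences_def)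
  next
    fix F G assume "F \<in> Fib (Ex_cat C)" "G \<in> Fib (Ex_cat C)" "Cod (Ex_cat C) F = Dom (Ex_cat C) G"
    then show "G \<cdot>\<^bsub>Ex_cat C\<^esub> F \<in> Fib (Ex_cat C)"
      using Ex_fib_comp[of "fst F" "fst (snd F)" "snd (snd F)" "fst (snd G)" "snd (snd G)"]
      by (cases F; cases G) simp
  next
    fix F G
    assume F: "F \<in> Fib (Ex_cat C)" and G: "G \<in> Arr (Ex_cat C)" "Cod (Ex_cat C) G = Cod (Ex_cat C) F"
    obtain A f B where f: "F = (A, f, B)" by (cases F) auto
    obtain D g where g: "G = (D, g, B)" using G f by (cases G) auto
    have "(A, f, B) \<in> Ex_fibrations C" "(D, g, B) \<in> Ex_arrows C" using F G f g by simp_all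
    then show "\<exists>p q. is_pullback (Ex_cat C) F G p q"
      unfolding f g by (rule Ex_pullback) blast
  next
    fix F G P Q assume "F \<in> Fib (Ex_cat C)" "is_pullback (Ex_cat C) F G P Q"
    then show "Q \<in> Fib (Ex_cat C)" using pb by simp
  next
    fix F G P Q
    assume "F \<in> Fib (Ex_cat C) \<inter> Weq (Ex_cat C)" "is_pullback (Ex_cat C) F G P Q"
    then show "Q \<in> Fib (Ex_cat C) \<inter> Weq (Ex_cat C)" using pb[of F G P Q] by simp
  next
    fix F G H A B D E
    assume "F \<in> Hom (Ex_cat C) A B" "G \<in> Hom (Ex_cat C) B D" "H \<in> Hom (Ex_cat C) D E"
      and weq: "G \<cdot>\<^bsub>Ex_cat C\<^esub> F \<in> Weq (Ex_cat C)" "H \<cdot>\<^bsub>Ex_cat C\<^esub> G \<in> Weq (Ex_cat C)"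
    then obtain f g h where F: "F = (A, f, B)" "(A, f, B) \<in> Ex_arrows C"
      and G: "G = (B, g, D)" "(B, g, D) \<in> Ex_arrows C"
      and H: "H = (D, h, E)" "(D, h, E) \<in> Ex_arrows C"
      unfolding in_Ex_Hom by blast
    show "F \<in> Weq (Ex_cat C) \<and> G \<in> Weq (Ex_cat C) \<and> H \<in> Weq (Ex_cat C) \<and>
        H \<cdot>\<^bsub>Ex_cat C\<^esub> G \<cdot>\<^bsub>Ex_cat C\<^esub> F \<in> Weq (Ex_cat C)"
      using Ex_two_out_of_six[OF F(2) G(2) H(2)] weq F(1) G(1) H(1) by simp
  next
    fix F assume "is_iso (Ex_cat C) F"
    then show "F \<in> Fib (Ex_cat C) \<inter> Weq (Ex_cat C)" using Ex_iso_acyclic_fib by simp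
  next
    fix F assume F: "F \<in> Fib (Ex_cat C) \<inter> Weq (Ex_cat C)"
    obtain A f B where f: "F = (A, f, B)" by (cases F) auto
    have fib: "(A, f, B) \<in> Ex_fibrations C" using F f by simp
    then have fa: "(A, f, B) \<in> Ex_arrows C" unfolding Ex_fib_iff by blast
    note B = Ex_arrowD(2)[OF fa] and A = Ex_arrowD(1)[OF fa] and fh = Ex_arrowD(3)[OF fa]
    obtain s where s: "s \<in> Hom C (fst B) (fst A)" "f \<cdot> s = \<one> (fst B)"
      and reflect: "\<And>D u v. \<lbrakk>u \<in> Hom C D (fst A); v \<in> Hom C D (fst A);
        related C B (f \<cdot> u) (f \<cdot> v)\<rbrakk> \<Longrightarrow> related C A u v"
      using F f Ex_acyclic_fib_iff[of A f B] by auto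
    \<comment> \<open>The characterisation only supplies a section in \<open>C\<close>; reflection
      of relations makes it a morphism of Ex.\<close>
    have "(B, s, A) \<in> Ex_arrows C"
    proof (rule Ex_arrowI[OF B A s(1)])
      fix D u v assume u: "u \<in> Hom C D (fst B)" and v: "v \<in> Hom C D (fst B)" and "related C B u v"
      then show "related C A (s \<cdot> u) (s \<cdot> v)"
        using reflect[OF comp_hom[OF u s(1)] comp_hom[OF v s(1)]] s(2)
          comp_assoc[OF u s(1) fh] comp_assoc[OF v s(1) fh] ident_left[OF u] ident_left[OF v] by simp
    qed
    then show "\<exists>S \<in> Hom (Ex_cat C) (Cod (Ex_cat C) F) (Dom (Ex_cat C) F).
        F \<cdot>\<^bsub>Ex_cat C\<^esub> S = \<one>\<^bsub>Ex_cat C\<^esub> (Cod (Ex_cat C) F)"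
      using s(2) f by (intro bexI[of _ "(B, s, A)"]) (auto simp: in_Ex_Hom)
  next
    fix B assume "B \<in> Obj (Ex_cat C)"
    then have B: "B \<in> her_objects C" by simp
    show "\<exists>r p. path_object (Ex_cat C) B r p"
      using Ex_path_object[OF B] by metis
  next
    obtain T where T: "is_terminal C T" "\<And>X. X \<in> Obj C \<Longrightarrow> Hom C X T \<subseteq> Fib C"
      using terminal by blast
    obtain r where r: "(T, r) \<in> her_objects C"
      "\<And>D u v. \<lbrakk>u \<in> Hom C D T; v \<in> Hom C D T\<rbrakk> \<Longrightarrow> related C (T, r) u v"
      using terminal_her[OF T(1)] by blast
    \<comment> \<open>The relation on \<open>T\<close> is total, so preserving relations is
      automatic for arrows into it.\<close>
    have arr: "(A, f, T, r) \<in> Ex_arrows C \<longleftrightarrow> f \<in> Hom C (fst A) T" if A: "A \<in> her_objects C" for A f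
    proof
      assume f: "f \<in> Hom C (fst A) T"
      show "(A, f, T, r) \<in> Ex_arrows C"
      proof (rule Ex_arrowI[OF A r(1)])
        fix D u v assume u: "u \<in> Hom C D (fst A)" and v: "v \<in> Hom C D (fst A)"
        show "related C (T, r) (f \<cdot> u) (f \<cdot> v)"
          by (rule r(2)[OF comp_hom[OF u f] comp_hom[OF v f]])
      qed (use f in simp)
    qed (use Ex_arrowD(3) in fastforce)
    have obj: "fst A \<in> Obj C" if A: "A \<in> her_objects C" for A
      using fibrant_relation_homs(1)[OF her_fibrant[OF A]] .
    have "is_terminal (Ex_cat C) (T, r)"
      unfolding is_terminal_def
    proof (intro conjI ballI)
      fix A assume "A \<in> Obj (Ex_cat C)"
      then have A: "A \<in> her_objects C" by simp
      obtain f where f: "f \<in> Hom C (fst A) T"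
        using T(1) obj[OF A] unfolding is_terminal_def by blast
      show "\<exists>!F. F \<in> Hom (Ex_cat C) A (T, r)"
      proof (rule ex1I)
        show "(A, f, (T, r)) \<in> Hom (Ex_cat C) A (T, r)"
          using f arr[OF A] by (simp add: in_Ex_Hom)
        fix G assume "G \<in> Hom (Ex_cat C) A (T, r)"
        then show "G = (A, f, (T, r))"
          using terminal_eq[OF T(1) _ f] arr[OF A] by (auto simp: in_Ex_Hom)
      qed
    qed (use r in simp)
    moreover have "F \<in> Ex_fibrations C"
      if A: "A \<in> her_objects C" and F: "F \<in> Hom (Ex_cat C) A (T, r)" for A F
    proof -
      obtain f where f: "F = (A, f, (T, r))" "(A, f, (T, r)) \<in> Ex_arrows C"
        using F unfolding in_Ex_Hom by blast
      have fh: "f \<in> Hom C (fst A) T" using f(2) arr[OF A] by simp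
      show ?thesis unfolding f(1)
      proof (rule Ex_fibI[OF f(2)])
        show "f \<in> Fib C" using T(2)[OF obj[OF A]] fh by blast
        fix D u w assume u: "u \<in> Hom C D (fst A)" and w: "w \<in> Hom C D (fst (T, r))"
        \<comment> \<open>Any two elements of \<open>T\<close> over the same domain are equal, so
          \<open>u\<close> is its own lift, related to itself by reflexivity.\<close>
        have "f \<cdot> u = w" using terminal_eq[OF T(1) comp_hom[OF u fh]] w by simp
        then show "\<exists>v \<in> Hom C D (fst A). related C A u v \<and> f \<cdot> v = w"
          using u her_refl[OF A u] by blast
      qed
    qed
    ultimately show "\<exists>T. is_terminal (Ex_cat C) T \<and>
        (\<forall>X \<in> Obj (Ex_cat C). Hom (Ex_cat C) X T \<subseteq> Fib (Ex_cat C))"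
      by (intro exI[of _ "(T, r)"] conjI ballI subsetI) simp_all
  qed
qed

end

section \<open>The homotopy category of Ex\<close>

text \<open>Arrows of the homotopy category are sets of triples, those of Hex are triples containing
  a set. Presenting both as images of Ex under a map \<open>c\<close> that fixes objects and
  respects composition lets them be compared through Ex.\<close>

definition quotient_of ::
  "('o, 'm, 'z) category_scheme \<Rightarrow> ('o, 'n, 'y) category_scheme \<Rightarrow> ('m \<Rightarrow> 'n) \<Rightarrow> bool" where
  "quotient_of C Q c \<longleftrightarrow> Obj Q = Obj C \<and> Arr Q = c ` Arr C \<and>
     (\<forall>f \<in> Arr C. Dom Q (c f) = Dom C f \<and> Cod Q (c f) = Cod C f) \<and>
     (\<forall>A \<in> Obj C. Ident Q A = c (Ident C A)) \<and>
     (\<forall>f \<in> Arr C. \<forall>g \<in> Arr C. Cod C f = Dom C g \<longrightarrow>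
        Comp Q (c g) (c f) = c (Comp C g f))"

context category
begin

context
  fixes Q :: "('o, 'n, 'y) category_scheme" and c
  assumes Q: "quotient_of C Q c"
begin

lemma quotient_Obj: "Obj Q = Obj C"
  using Q unfolding quotient_of_def by blast

lemma quotient_Hom: "Hom Q A B = c ` Hom C A B"
  using Q unfolding quotient_of_def Hom_def by auto

lemma quotient_Ident: "A \<in> Obj C \<Longrightarrow> Ident Q A = c (\<one> A)"
  using Q unfolding quotient_of_def by blast

lemma quotient_Comp: "\<lbrakk>f \<in> Hom C A B; g \<in> Hom C B D\<rbrakk> \<Longrightarrow> Comp Q (c g) (c f) = c (g \<cdot> f)"
  using Q unfolding quotient_of_def by (simp add: in_Hom)

text \<open>Every hom-set of \<open>Q\<close> is the image of the corresponding hom-set of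
  \<open>C\<close>, so the category laws may be checked on representatives.\<close>

lemma quotient_category: "category Q"
proof
  fix F assume "F \<in> Arr Q"
  then have "F \<in> Hom Q (Dom Q F) (Cod Q F)" by (simp add: in_Hom)
  then have "F \<in> c ` Hom C (Dom Q F) (Cod Q F)" using quotient_Hom by simp
  then show "Dom Q F \<in> Obj Q" "Cod Q F \<in> Obj Q"
    using Hom_dom_obj Hom_cod_obj quotient_Obj by auto
next
  fix A assume "A \<in> Obj Q"
  then show "Ident Q A \<in> Hom Q A A"
    using quotient_Obj quotient_Hom quotient_Ident ident_hom by simp
next
  fix F G A B D assume "F \<in> Hom Q A B" "G \<in> Hom Q B D"
  then obtain f g where "F = c f" "G = c g" and fg: "f \<in> Hom C A B" "g \<in> Hom C B D"
    using quotient_Hom by auto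
  then show "Comp Q G F \<in> Hom Q A D"
    using quotient_Comp[OF fg] comp_hom[OF fg] quotient_Hom by simp
next
  fix F A B assume "F \<in> Hom Q A B"
  then obtain f where F: "F = c f" and f: "f \<in> Hom C A B" using quotient_Hom by auto
  have obj: "A \<in> Obj C" "B \<in> Obj C" using Hom_dom_obj Hom_cod_obj f by blast+
  show "Comp Q (Ident Q B) F = F" "Comp Q F (Ident Q A) = F"
    unfolding F using quotient_Ident obj quotient_Comp[OF f ident_hom] quotient_Comp[OF ident_hom f]
      ident_left[OF f] ident_right[OF f] by simp_all
next
  fix F G H A B D E assume "F \<in> Hom Q A B" "G \<in> Hom Q B D" "H \<in> Hom Q D E"
  then obtain f g h where F: "F = c f" "G = c g" "H = c h"
    and f: "f \<in> Hom C A B" and g: "g \<in> Hom C B D" and h: "h \<in> Hom C D E"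
    using quotient_Hom by auto
  show "Comp Q (Comp Q H G) F = Comp Q H (Comp Q G F)"
    unfolding F quotient_Comp[OF f g] quotient_Comp[OF g h]
      quotient_Comp[OF f comp_hom[OF g h]] quotient_Comp[OF comp_hom[OF f g] h]
    using comp_assoc[OF f g h] by simp
qed

end

lemma quotient_functor:
  assumes Q: "quotient_of C Q c" and Q': "quotient_of C Q' c'"
    and F: "\<And>f. f \<in> Arr C \<Longrightarrow> F (c f) = c' f"
  shows "cat_functor Q Q' id F"
proof (intro cat_functor.intro quotient_category[OF Q] quotient_category[OF Q'])
  note q = quotient_Obj[OF Q] quotient_Hom[OF Q] quotient_Ident[OF Q] quotient_Comp[OF Q]
  note q' = quotient_Obj[OF Q'] quotient_Hom[OF Q'] quotient_Ident[OF Q'] quotient_Comp[OF Q']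
  have F': "F (c f) = c' f" if "f \<in> Hom C A B" for f A B using F that by (simp add: in_Hom)
  show "cat_functor_axioms Q Q' id F"
  proof
    fix A assume "A \<in> Obj Q"
    then show "id A \<in> Obj Q'" "F (Ident Q A) = Ident Q' (id A)"
      using q q' F'[OF ident_hom] by simp_all
  next
    fix X A B assume "X \<in> Hom Q A B"
    then show "F X \<in> Hom Q' (id A) (id B)"
      using q q' F' by auto
  next
    fix X Y A B D assume "X \<in> Hom Q A B" "Y \<in> Hom Q B D"
    then obtain f g where "X = c f" "Y = c g" and fg: "f \<in> Hom C A B" "g \<in> Hom C B D"
      using q by auto
    then show "F (Comp Q Y X) = Comp Q' (F Y) (F X)"
      using q(4)[OF fg] q'(4)[OF fg] F'[OF fg(1)] F'[OF fg(2)] F'[OF comp_hom[OF fg]] by simp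
  qed
qed

text \<open>\<open>F\<close> equals the identity on arrows of \<open>C\<close> only; outside the
  carrier it may take any value. The two functors are therefore not equal as functions, and identity
  arrows serve as the components of the isomorphism.\<close>

lemma naturally_isomorphic_idI:
  assumes F: "cat_functor C C id F" and eq: "\<And>f. f \<in> Arr C \<Longrightarrow> F f = f"
  shows "naturally_isomorphic C C id F id id"
  unfolding naturally_isomorphic_def
proof (intro conjI F exI[of _ "Ident C"] ballI)
  show "cat_functor C C id id"
    by (intro cat_functor.intro category_axioms cat_functor_axioms.intro) auto
next
  fix X assume "X \<in> Obj C"
  then have X: "\<one> X \<in> Hom C X X" by (rule ident_hom)
  show "\<one> X \<in> Hom C (id X) (id X)" using X by simp
  show "is_iso C (\<one> X)" using isoI[OF X X] ident_left[OF X] by simp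
next
  fix f assume "f \<in> Arr C"
  then show "id f \<cdot> \<one> (Dom C f) = \<one> (Cod C f) \<cdot> F f"
    using eq arr_simps(5,6)[of f] by simp
qed

text \<open>Two quotient maps with the same kernel. Each arrow map picks a representative with
  \<open>inv_into\<close> and takes its other class; equality of kernels makes the picked
  representative irrelevant and the two maps mutually inverse on arrows.\<close>

lemma quotients_equivalent:
  assumes Q: "quotient_of C Q c" and Q': "quotient_of C Q' c'"
    and eq: "\<And>f g. \<lbrakk>f \<in> Arr C; g \<in> Arr C\<rbrakk> \<Longrightarrow> c f = c g \<longleftrightarrow> c' f = c' g"
  shows "equivalent_categories Q Q'"
proof -
  define F where "F x = c' (inv_into (Arr C) c x)" for x
  define G where "G x = c (inv_into (Arr C) c' x)" for x
  have F: "F (c f) = c' f" if f: "f \<in> Arr C" for f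
    unfolding F_def
    using eq[OF inv_into_into[of "c f" c "Arr C"] f] f_inv_into_f[of "c f" c "Arr C"] f by simp
  have G: "G (c' f) = c f" if f: "f \<in> Arr C" for f
    unfolding G_def
    using eq[OF inv_into_into[of "c' f" c' "Arr C"] f] f_inv_into_f[of "c' f" c' "Arr C"] f by simp
  have arr: "Arr Q = c ` Arr C" "Arr Q' = c' ` Arr C"
    using Q Q' unfolding quotient_of_def by auto
  interpret Q: category Q by (rule quotient_category[OF Q])
  interpret Q': category Q' by (rule quotient_category[OF Q'])
  have "cat_functor Q Q id (G \<circ> F)" "cat_functor Q' Q' id (F \<circ> G)"
    using quotient_functor[OF Q Q, of "G \<circ> F"] quotient_functor[OF Q' Q', of "F \<circ> G"] F G
    by simp_all
  moreover have "(G \<circ> F) x = x" if "x \<in> Arr Q" for x using that arr F G by auto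
  moreover have "(F \<circ> G) x = x" if "x \<in> Arr Q'" for x using that arr F G by auto
  ultimately have
    "naturally_isomorphic Q Q id (G \<circ> F) id id" "naturally_isomorphic Q' Q' id (F \<circ> G) id id"
    using Q.naturally_isomorphic_idI Q'.naturally_isomorphic_idI by blast+
  moreover have "cat_functor Q Q' id F" "cat_functor Q' Q id G"
    using quotient_functor[OF Q Q', of F] quotient_functor[OF Q' Q, of G] F G by blast+
  ultimately show ?thesis
    unfolding equivalent_categories_def
    by (intro exI[of _ id] exI[of _ F] exI[of _ G]) simp
qed

end

section \<open>Homotopy in Ex versus identification in Hex\<close>

context path_category
begin

lemma Ex_homotopic_iff:
  assumes f: "(A, f, B) \<in> Ex_arrows C"
  shows "homotopic (Ex_cat C) (A, f, B) G \<longleftrightarrow> (\<exists>g. G = (A, g, B) \<and> tracked_equiv C A B f g)"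
proof
  interpret E: category_with_products "Ex_cat C" by (rule Ex_category_with_products)
  note A = Ex_arrowD(1)[OF f] and B = Ex_arrowD(2)[OF f] and fh = Ex_arrowD(3)[OF f]
  have BE: "B \<in> Obj (Ex_cat C)" using B by simp
  assume "homotopic (Ex_cat C) (A, f, B) G"
  then obtain r p h where G: "G \<in> Hom (Ex_cat C) A B"
    and po: "path_object (Ex_cat C) B r p" and h: "h \<in> Hom (Ex_cat C) A (Dom (Ex_cat C) p)"
    and ph: "comp1 (Ex_cat C) B p \<cdot>\<^bsub>Ex_cat C\<^esub> h = (A, f, B)"
      "comp2 (Ex_cat C) B p \<cdot>\<^bsub>Ex_cat C\<^esub> h = G"
    unfolding homotopic_def using f by (auto simp: in_Ex_Hom)
  obtain g where g: "G = (A, g, B)" "(A, g, B) \<in> Ex_arrows C" using G unfolding in_Ex_Hom by blast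
  let ?P = "Dom (Ex_cat C) p"
  have r: "r \<in> Hom (Ex_cat C) B ?P" and p: "p \<in> Hom (Ex_cat C) ?P (prod_obj (Ex_cat C) B B)"
    and weq: "r \<in> Ex_weak_equivalences C" and pr: "p \<cdot>\<^bsub>Ex_cat C\<^esub> r = diag (Ex_cat C) B"
    using po unfolding path_object_def by simp_all
  obtain s where s: "comp1 (Ex_cat C) B p = (?P, s, B)" "(?P, s, B) \<in> Ex_arrows C"
    using E.comp1_hom[OF BE p] unfolding in_Ex_Hom by blast
  obtain t where t: "comp2 (Ex_cat C) B p = (?P, t, B)" "(?P, t, B) \<in> Ex_arrows C"
    using E.comp2_hom[OF BE p] unfolding in_Ex_Hom by blast
  obtain i where i: "r = (B, i, ?P)" "(B, i, ?P) \<in> Ex_arrows C" using r unfolding in_Ex_Hom by blast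
  obtain h' where h': "h = (A, h', ?P)" "(A, h', ?P) \<in> Ex_arrows C"
    using h unfolding in_Ex_Hom by blast
  have si: "s \<cdot> i = \<one> (fst B)" and ti: "t \<cdot> i = \<one> (fst B)"
    using E.comp1_comp[OF BE p r] E.comp2_comp[OF BE p r] E.comp_diag[OF BE] pr s(1) t(1) i(1)
    by simp_all
  obtain k where k: "(?P, k, B) \<in> Ex_arrows C" and ik: "related C ?P (i \<cdot> k) (\<one> (fst ?P))"
    using weq Ex_weq_iff[of B i ?P] i(1) unfolding inverse_up_to_homotopy_def by auto
  note ih = Ex_arrowD(3)[OF i(2)] and kh = Ex_arrowD(3)[OF k] and hh = Ex_arrowD(3)[OF h'(2)]
  \<comment> \<open>For a retraction \<open>x\<close> of \<open>i\<close>, applying \<open>x\<close>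
    to \<open>i k ~ 1\<close> gives \<open>k = x i k ~ x\<close>. Both legs of the path object are
    such retractions.\<close>
  have k_rel: "related C B k x" and k_hom: "x \<in> Hom C (fst ?P) (fst B)"
    if x: "(?P, x, B) \<in> Ex_arrows C" and xi: "x \<cdot> i = \<one> (fst B)" for x
  proof -
    show xh: "x \<in> Hom C (fst ?P) (fst B)" using Ex_arrowD(3)[OF x] .
    show "related C B k x"
      using Ex_arrowD(4)[OF x ik comp_hom[OF kh ih] ident_hom[OF Hom_dom_obj[OF kh]]]
        comp_assoc[OF kh ih xh] xi ident_left[OF kh] ident_right[OF xh] by simp
  qed
  note sh = k_hom[OF s(2) si] and th = k_hom[OF t(2) ti]
  have "related C B s t"
    using her_trans[OF B her_sym[OF B k_rel[OF s(2) si] kh sh] k_rel[OF t(2) ti] sh kh] .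
  then have "related C B (s \<cdot> h') (t \<cdot> h')"
    using related_precomp[OF her_fibrant[OF B] _ sh hh] by blast
  moreover have "s \<cdot> h' = f" "t \<cdot> h' = g" using ph s(1) t(1) h'(1) g(1) by simp_all
  ultimately show "\<exists>g. G = (A, g, B) \<and> tracked_equiv C A B f g"
    using tracked_equiv_iff[OF A B] f g by blast
next
  note A = Ex_arrowD(1)[OF f] and B = Ex_arrowD(2)[OF f] and fh = Ex_arrowD(3)[OF f]
  assume "\<exists>g. G = (A, g, B) \<and> tracked_equiv C A B f g"
  then obtain g where G: "G = (A, g, B)" and g: "(A, g, B) \<in> Ex_arrows C"
    and fg: "related C B f g"
    using tracked_equiv_iff[OF A B] by blast
  obtain h where h: "h \<in> Hom C (fst A) (Rel B)" "src B \<cdot> h = f" "tgt B \<cdot> h = g"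
    using relatedE[OF fg fh] .
  obtain P r p where P: "path_object (Ex_cat C) B r p" "Dom (Ex_cat C) p = P" "P \<in> her_objects C"
    and fstP: "fst P = Rel B"
    and st: "comp1 (Ex_cat C) B p = (P, src B, B)" "comp2 (Ex_cat C) B p = (P, tgt B, B)"
    and rel: "\<forall>D. \<forall>u \<in> Hom C D (fst P). \<forall>v \<in> Hom C D (fst P).
       related C P u v \<longleftrightarrow> related C B (src B \<cdot> u) (src B \<cdot> v)"
    using Ex_path_object[OF B] .
  note hB = fibrant_relation_homs[OF her_fibrant[OF B]]
  \<comment> \<open>A witness of \<open>f ~ g\<close> is an arrow of \<open>C\<close> into
    \<open>R\<close>. It is a morphism of Ex because relatedness in \<open>P\<close> is tested on
    sources and \<open>src B h = f\<close> preserves relations.\<close>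
  have "(A, h, P) \<in> Ex_arrows C"
  proof (rule Ex_arrowI[OF A P(3)])
    show "h \<in> Hom C (fst A) (fst P)" using h fstP by simp
    fix D u v assume u: "u \<in> Hom C D (fst A)" and v: "v \<in> Hom C D (fst A)" and r: "related C A u v"
    show "related C P (h \<cdot> u) (h \<cdot> v)"
      using rel[THEN spec, of D] comp_hom[OF u h(1)] comp_hom[OF v h(1)] fstP
        comp_assoc[OF u h(1) hB(3)] comp_assoc[OF v h(1) hB(3)] h(2) Ex_arrowD(4)[OF f r u v] by simp
  qed
  then have "(A, h, P) \<in> Hom (Ex_cat C) A (Dom (Ex_cat C) p)"
    and "(A, f, B) \<in> Hom (Ex_cat C) A B" "G \<in> Hom (Ex_cat C) A B"
    using f g G P(2) by (auto simp: in_Ex_Hom)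
  moreover have "comp1 (Ex_cat C) B p \<cdot>\<^bsub>Ex_cat C\<^esub> (A, h, P) = (A, f, B)"
    "comp2 (Ex_cat C) B p \<cdot>\<^bsub>Ex_cat C\<^esub> (A, h, P) = G"
    using st h G by simp_all
  ultimately show "homotopic (Ex_cat C) (A, f, B) G"
    unfolding homotopic_def using P(1) by blast
qed

lemma Ex_homotopy_class:
  assumes "(A, f, B) \<in> Ex_arrows C"
  shows "homotopy_class (Ex_cat C) (A, f, B) = (\<lambda>g. (A, g, B)) ` tracked_class C A B f"
  using Ex_homotopic_iff[OF assms] unfolding homotopy_class_def tracked_class_def by auto

text \<open>Supplies nonemptiness of the classes, on which the \<open>SOME\<close> in domains and
  codomains and the unions in composition depend.\<close>

lemma tracked_class_self:
  assumes f: "(A, f, B) \<in> Ex_arrows C"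
  shows "f \<in> tracked_class C A B f"
  using tracked_equiv_iff[OF Ex_arrowD(1,2)[OF f]] f her_refl[OF Ex_arrowD(2,3)[OF f]]
  unfolding tracked_class_def by blast

lemma tracked_class_eq:
  assumes f: "(A, f, B) \<in> Ex_arrows C" and eq: "tracked_equiv C A B f g"
  shows "tracked_class C A B f = tracked_class C A B g"
proof -
  note A = Ex_arrowD(1)[OF f] and B = Ex_arrowD(2)[OF f] and fh = Ex_arrowD(3)[OF f]
  have g: "(A, g, B) \<in> Ex_arrows C" and r: "related C B f g"
    using eq tracked_equiv_iff[OF A B] by auto
  note gh = Ex_arrowD(3)[OF g]
  note r' = her_sym[OF B r fh gh]
  have "related C B f x \<longleftrightarrow> related C B g x" for x
    using her_trans[OF B r _ fh gh] her_trans[OF B r' _ gh fh] by blast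
  then show ?thesis unfolding tracked_class_def using tracked_equiv_iff[OF A B] f g by auto
qed

text \<open>The congruence property, from \<open>g f ~ g f' ~ g' f'\<close>. It makes the families
  whose unions define composition constant.\<close>

lemma tracked_class_comp:
  assumes f: "(A, f, B) \<in> Ex_arrows C" and g: "(B, g, D) \<in> Ex_arrows C"
    and f': "f' \<in> tracked_class C A B f" and g': "g' \<in> tracked_class C B D g"
  shows "(A, g' \<cdot> f', D) \<in> Ex_arrows C" "tracked_class C A D (g' \<cdot> f') = tracked_class C A D (g \<cdot> f)"
proof -
  note A = Ex_arrowD(1)[OF f] and B = Ex_arrowD(2)[OF f] and D = Ex_arrowD(2)[OF g]
  have fa': "(A, f', B) \<in> Ex_arrows C" and rf: "related C B f f'"
    using f' tracked_equiv_iff[OF A B] unfolding tracked_class_def by auto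
  have ga': "(B, g', D) \<in> Ex_arrows C" and rg: "related C D g g'"
    using g' tracked_equiv_iff[OF B D] unfolding tracked_class_def by auto
  note fh = Ex_arrowD(3)[OF f] and gh = Ex_arrowD(3)[OF g]
    and fh' = Ex_arrowD(3)[OF fa'] and gh' = Ex_arrowD(3)[OF ga']
  show a: "(A, g' \<cdot> f', D) \<in> Ex_arrows C" by (rule Ex_arrow_comp[OF fa' ga'])
  have "related C D (g \<cdot> f) (g' \<cdot> f')"
    using her_trans[OF D Ex_arrowD(4)[OF g rf fh fh']
        related_precomp[OF her_fibrant[OF D] rg gh fh'] comp_hom[OF fh gh] comp_hom[OF fh' gh]] .
  then show "tracked_class C A D (g' \<cdot> f') = tracked_class C A D (g \<cdot> f)"
    using tracked_class_eq[OF Ex_arrow_comp[OF f g]] tracked_equiv_iff[OF A D]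
      Ex_arrow_comp[OF f g] a by blast
qed

section \<open>The homotopy category and Hex as quotients of Ex\<close>

lemma Ex_quotientI:
  assumes "Obj Q = her_objects C" "Arr Q = c ` Ex_arrows C"
    and ident: "\<And>A. A \<in> her_objects C \<Longrightarrow> Ident Q A = c (A, \<one> (fst A), A)"
    and dom_cod: "\<And>A f B. (A, f, B) \<in> Ex_arrows C
      \<Longrightarrow> Dom Q (c (A, f, B)) = A \<and> Cod Q (c (A, f, B)) = B"
    and comp: "\<And>A f B g D. \<lbrakk>(A, f, B) \<in> Ex_arrows C; (B, g, D) \<in> Ex_arrows C\<rbrakk>
      \<Longrightarrow> Comp Q (c (B, g, D)) (c (A, f, B)) = c (A, g \<cdot> f, D)"
  shows "quotient_of (Ex_cat C) Q c"
  unfolding quotient_of_def Ex_cat_simps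
proof (intro conjI ballI impI)
  fix F assume "F \<in> Ex_arrows C"
  then show "Dom Q (c F) = Dom (Ex_cat C) F" "Cod Q (c F) = Cod (Ex_cat C) F"
    using dom_cod[of "fst F" "fst (snd F)" "snd (snd F)"] by (cases F; simp)+
  fix G assume "G \<in> Ex_arrows C" "Cod (Ex_cat C) F = Dom (Ex_cat C) G"
  then show "Comp Q (c G) (c F) = c (G \<cdot>\<^bsub>Ex_cat C\<^esub> F)"
    using \<open>F \<in> Ex_arrows C\<close>
      comp[of "fst F" "fst (snd F)" "snd (snd F)" "fst (snd G)" "snd (snd G)"]
    by (cases F; cases G; simp)
qed (use assms(1,2) ident in simp_all)

lemma homotopy_category_quotient:
  "quotient_of (Ex_cat C) (homotopy_category (Ex_cat C)) (homotopy_class (Ex_cat C))"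
proof -
  let ?H = "homotopy_category (Ex_cat C)" and ?c = "homotopy_class (Ex_cat C)"
  have "Dom ?H (?c (A, f, B)) = A \<and> Cod ?H (?c (A, f, B)) = B"
    if f: "(A, f, B) \<in> Ex_arrows C" for A f B
  proof -
    have "(A, f, B) \<in> ?c (A, f, B)"
      using tracked_class_self[OF f] Ex_homotopy_class[OF f] by blast
    \<comment> \<open>The representative picked by \<open>SOME\<close> is a member of the class, and
      all members share their outer components.\<close>
    then have "(SOME F. F \<in> ?c (A, f, B)) \<in> ?c (A, f, B)" by (rule someI)
    then obtain g where "(SOME F. F \<in> ?c (A, f, B)) = (A, g, B)"
      unfolding Ex_homotopy_class[OF f] by blast
    then show ?thesis by (simp add: homotopy_category_def)
  qed
  moreover have "Comp ?H (?c (B, g, D)) (?c (A, f, B)) = ?c (A, g \<cdot> f, D)"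
    if f: "(A, f, B) \<in> Ex_arrows C" and g: "(B, g, D) \<in> Ex_arrows C" for A f B g D
  proof -
    have "?c (G \<cdot>\<^bsub>Ex_cat C\<^esub> F) = ?c (A, g \<cdot> f, D)"
      if G: "G \<in> ?c (B, g, D)" and F: "F \<in> ?c (A, f, B)" for F G
    proof -
      obtain f' g' where FG: "F = (A, f', B)" "G = (B, g', D)"
        and *: "f' \<in> tracked_class C A B f" "g' \<in> tracked_class C B D g"
        using F G unfolding Ex_homotopy_class[OF f] Ex_homotopy_class[OF g] by blast
      show ?thesis
        using tracked_class_comp(2)[OF f g *] unfolding FG Ex_cat_simps
          Ex_homotopy_class[OF tracked_class_comp(1)[OF f g *]]
          Ex_homotopy_class[OF Ex_arrow_comp[OF f g]] by simp
    qed
    moreover have "(A, f, B) \<in> ?c (A, f, B)" "(B, g, D) \<in> ?c (B, g, D)"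
      using tracked_class_self[OF f] tracked_class_self[OF g]
      unfolding Ex_homotopy_class[OF f] Ex_homotopy_class[OF g] by blast+
    \<comment> \<open>Both unions range over nonempty sets and all their terms are equal.\<close>
    ultimately have "(\<Union>G \<in> ?c (B, g, D). \<Union>F \<in> ?c (A, f, B). ?c (G \<cdot>\<^bsub>Ex_cat C\<^esub> F))
        = ?c (A, g \<cdot> f, D)"
      by (intro UN_constant_eq[of "(B, g, D)"] UN_constant_eq[of "(A, f, B)"] ballI) simp_all
    then show ?thesis by (simp add: homotopy_category_def)
  qed
  ultimately show ?thesis
    by (intro Ex_quotientI) (simp_all add: homotopy_category_def)
qed

lemma Hex_quotient: "quotient_of (Ex_cat C) (Hex_cat C) (\<lambda>(A, f, B). (A, tracked_class C A B f, B))"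
    (is "quotient_of _ _ ?c")
proof -
  have "F \<in> Arr (Hex_cat C) \<longleftrightarrow> (\<exists>A f B. (A, f, B) \<in> Ex_arrows C \<and> F = ?c (A, f, B))" for F
    by (simp add: Hex_cat_def Ex_arrows_def) blast
  then have "Arr (Hex_cat C) = ?c ` Ex_arrows C" by (auto simp: image_iff Bex_def)
  moreover have "Comp (Hex_cat C) (?c (B, g, D)) (?c (A, f, B)) = ?c (A, g \<cdot> f, D)"
    if f: "(A, f, B) \<in> Ex_arrows C" and g: "(B, g, D) \<in> Ex_arrows C" for A f B g D
  proof -
    have "(\<Union>g' \<in> tracked_class C B D g. \<Union>f' \<in> tracked_class C A B f.
        tracked_class C A D (g' \<cdot> f')) = tracked_class C A D (g \<cdot> f)"
      by (intro UN_constant_eq[of g] UN_constant_eq[of f] ballI tracked_class_comp(2)[OF f g]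
          tracked_class_self[OF f] tracked_class_self[OF g])
    then show ?thesis by (simp add: Hex_cat_def)
  qed
  ultimately show ?thesis
    by (intro Ex_quotientI) (simp_all add: Hex_cat_def)
qed

text \<open>A homotopy class is nonempty, so it determines its two endpoints; with these fixed,
  adding them to a map is injective and the underlying classes of maps agree as well.\<close>

lemma homotopy_class_eq_iff:
  assumes F: "(A, f, B) \<in> Ex_arrows C" and G: "(A', g, B') \<in> Ex_arrows C"
  shows "homotopy_class (Ex_cat C) (A, f, B) = homotopy_class (Ex_cat C) (A', g, B') \<longleftrightarrow>
    (A, tracked_class C A B f, B) = (A', tracked_class C A' B' g, B')"
proof
  assume eq: "homotopy_class (Ex_cat C) (A, f, B) = homotopy_class (Ex_cat C) (A', g, B')"
  then have *: "(\<lambda>x. (A, x, B)) ` tracked_class C A B f = (\<lambda>x. (A', x, B')) ` tracked_class C A' B' g"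
    unfolding Ex_homotopy_class[OF F] Ex_homotopy_class[OF G] .
  then have AB: "A = A'" "B = B'" using tracked_class_self[OF F] by blast+
  have "inj (\<lambda>x. (A, x, B))" by (simp add: inj_on_def)
  then have "tracked_class C A B f = tracked_class C A' B' g"
    by (rule iffD1[OF inj_image_eq_iff]) (use * AB in simp)
  with AB show "(A, tracked_class C A B f, B) = (A', tracked_class C A' B' g, B')" by simp
qed (use Ex_homotopy_class F G in auto)

lemma homotopy_category_equivalent_Hex:
  "equivalent_categories (homotopy_category (Ex_cat C)) (Hex_cat C)"
proof (rule category.quotients_equivalent
    [OF Ex_category homotopy_category_quotient Hex_quotient])
  fix F G assume "F \<in> Arr (Ex_cat C)" "G \<in> Arr (Ex_cat C)"
  then show "homotopy_class (Ex_cat C) F = homotopy_class (Ex_cat C) G \<longleftrightarrow>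
    (case F of (A, f, B) \<Rightarrow> (A, tracked_class C A B f, B)) =
    (case G of (A, f, B) \<Rightarrow> (A, tracked_class C A B f, B))"
    using homotopy_class_eq_iff by (cases F; cases G) simp
qed

end

theorem theorem3p14:
  fixes C :: "('o, 'm) path_structure"
  assumes "path_category C"
  shows "path_category (Ex_cat C) \<and> equivalent_categories (homotopy_category (Ex_cat C)) (Hex_cat C)"
  using path_category.Ex_path_category[OF assms]
    path_category.homotopy_category_equivalent_Hex[OF assms] ..

end
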